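(* Let $A$ be a central division algebra over a field $F$. (i) If $A$ has prime degree, then either $A$ is a cyclic algebra or each of its maximal subfields $M$ has trivial automorphism group $\mathrm{Aut}_F(M)$. (ii) Suppose $A$ contains a maximal subfield $M$ such that $G=\mathrm{Aut}_F(M)$ is non-trivial. Then $A$ contains the $G$-crossed product division algebra $M(G)=(M,G,\mathfrak a)$ of degree $|G|$ over $\mathrm{Fix}(G)$ as a subalgebra.
   Context: All algebras are unital, associative and finite-dimensional. A central simple algebra $A$ over $F$ has degree $n$ if $\dim_F A=n^2$; a maximal subfield of $A$ is a subfield $M\supseteq F$ of $A$ with $[M:F]=n$. $\mathrm{Fix}(G)$ is the fixed field of $G$ in $M$. For a Galois extension $M/Z$ with group $G$ and a 2-cocycle (factor set) $\mathfrak a:G\times G\to M^\times$, $(\sigma,\tau)\mapsto a_{\sigma,\tau}$, i.e. $a_{\sigma,\tau}a_{\sigma\tau,\rho}=a_{\sigma,\tau\rho}\sigma(a_{\tau,\rho})$, the crossed product algebra $(M,G,\mathfrak a)$ over $Z$ is $\bigoplus_{\sigma\in G}Mx_\sigma$ with $x_\sigma m=\sigma(m)x_\sigma$ and $x_\sigma x_\tau=a_{\sigma,\tau}x_{\sigma\tau}$. A cyclic algebra of degree $n$ over $F$ is such a crossed product with $M/F$ cyclic of degree $n$, equivalently $M[t;\sigma]/M[t;\sigma](t^n-c)$ with $\langle\sigma\rangle=\mathrm{Gal}(M/F)$, $c\in F^\times$. $M(G)$: by Skolem–Noether, for each $\sigma\in G=\mathrm{Aut}_F(M)$ there is an invertible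 $x_\sigma\in A$ with $x_\sigma m x_\sigma^{-1}=\sigma(m)$ for all $m\in M$, unique up to left multiplication by $M^\times$; $M(G)$ is the left $M$-span of $\{x_\sigma:\sigma\in G\}$ in $A$, and $\mathfrak a$ is given by the elements $a_{\sigma,\tau}\in M^\times$ with $x_\sigma x_\tau=a_{\sigma,\tau}x_{\sigma\tau}$. *)

theory Defs
  imports
    "HOL-Computational_Algebra.Primes"
    "HOL-Algebra.Embedded_Algebras"
    "HOL-Algebra.Elementary_Groups"
    "HOL-Algebra.Bij"
begin

section \<open>Central division algebras\<close>

definition ring_center :: "('a, 'b) ring_scheme \<Rightarrow> 'a set" where
  "ring_center R = {z \<in> carrier R. \<forall>x \<in> carrier R. z \<otimes>\<^bsub>R\<^esub> x = x \<otimes>\<^bsub>R\<^esub> z}"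

text \<open>The base field is identified with its image in the algebra, so that centrality is the
  equation of \<open>F\<close> with the centre. Nontriviality of \<open>A\<close> is part of \<open>subfield F A\<close>.\<close>

locale central_division_algebra = ring A for F and A (structure) +
  assumes base_subfield: "subfield F A"
    and center_eq: "ring_center A = F"
    and finite_dim: "finite_dimension F (carrier A)"
    and division: "Units A = carrier A - {\<zero>}"

definition has_degree :: "'a set \<Rightarrow> ('a, 'b) ring_scheme \<Rightarrow> nat \<Rightarrow> bool" where
  "has_degree F A n \<longleftrightarrow> ring.dimension A (n\<^sup>2) F (carrier A)"

text \<open>As is customary for central simple algebras, maximality refers to the degree.\<close>

definition maximal_subfield :: "'a set \<Rightarrow> ('a, 'b) ring_scheme \<Rightarrow> 'a set \<Rightarrow> bool" where
  "maximal_subfield F A M \<longleftrightarrow>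
     subfield M A \<and> F \<subseteq> M \<and> (\<exists>n. has_degree F A n \<and> ring.dimension A n F M)"


section \<open>Automorphism groups and Galois extensions\<close>

text \<open>Automorphisms of \<open>R\<close> fixing \<open>F\<close> pointwise. As in \<^const>\<open>BijGroup\<close>, only functions that are
  extensional on the carrier are used, so that each automorphism is counted once.\<close>

definition aut_group :: "'a set \<Rightarrow> ('a, 'b) ring_scheme \<Rightarrow> ('a \<Rightarrow> 'a) monoid" where
  "aut_group F R = (BijGroup (carrier R))
     \<lparr>carrier := {\<sigma> \<in> ring_iso R R \<inter> extensional (carrier R). \<forall>z \<in> F. \<sigma> z = z}\<rparr>"

definition fixed_field :: "('a, 'b) ring_scheme \<Rightarrow> ('a \<Rightarrow> 'a) monoid \<Rightarrow> 'a set" where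
  "fixed_field R G = {m \<in> carrier R. \<forall>\<sigma> \<in> carrier G. \<sigma> m = m}"

text \<open>Finite Galois extensions.\<close>

definition galois_extension :: "'a set \<Rightarrow> ('a, 'b) ring_scheme \<Rightarrow> bool" where
  "galois_extension Z M \<longleftrightarrow>
     field M \<and> subfield Z M \<and> ring.finite_dimension M Z (carrier M) \<and>
     fixed_field M (aut_group Z M) = Z"

lemma (in ring) group_aut_group:
  assumes "F \<subseteq> carrier R"
  shows "group (aut_group F R)"
proof -
  let ?C = "{\<sigma> \<in> ring_iso R R \<inter> extensional (carrier R). \<forall>z \<in> F. \<sigma> z = z}"
  have "subgroup ?C (BijGroup (carrier R))"
  proof (rule subgroup.intro)
    show "?C \<subseteq> carrier (BijGroup (carrier R))"
      by (auto simp: BijGroup_def Bij_def ring_iso_def)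
  next
    fix s t assume s: "s \<in> ?C" and t: "t \<in> ?C"
    have B: "s \<in> Bij (carrier R)" "t \<in> Bij (carrier R)"
      using s t by (auto simp: Bij_def ring_iso_def)
    have st: "s \<otimes>\<^bsub>BijGroup (carrier R)\<^esub> t = compose (carrier R) s t"
      using B by (simp add: BijGroup_def)
    have "s \<circ> t \<in> ring_iso R R" using s t ring_iso_set_trans by blast
    then have "compose (carrier R) s t \<in> ring_iso R R"
      by (rule ring_iso_restrict) (simp add: compose_def)
    then show "s \<otimes>\<^bsub>BijGroup (carrier R)\<^esub> t \<in> ?C"
      using s t assms unfolding st by (auto simp: compose_def subset_iff)
  next
    show "\<one>\<^bsub>BijGroup (carrier R)\<^esub> \<in> ?C"
      using assms by (auto simp: BijGroup_def ring_iso_def ring_hom_def bij_betw_def inj_on_def)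
  next
    fix s assume s: "s \<in> ?C"
    then have B: "s \<in> Bij (carrier R)" by (auto simp: Bij_def ring_iso_def)
    have "inv_into (carrier R) s \<in> ring_iso R R"
      using s ring_iso_set_sym[OF ring_axioms] by blast
    then have I: "(\<lambda>x\<in>carrier R. inv_into (carrier R) s x) \<in> ring_iso R R"
      by (rule ring_iso_restrict) simp
    have "inj_on s (carrier R)" using B by (auto simp: Bij_def bij_betw_def)
    then have "inv_into (carrier R) s z = z" if "z \<in> F" for z
      using s assms that inv_into_f_f[of s "carrier R" z] by auto
    then show "inv\<^bsub>BijGroup (carrier R)\<^esub> s \<in> ?C"
      using I assms unfolding inv_BijGroup[OF B] by auto
  qed
  then show ?thesis
    unfolding aut_group_def by (rule subgroup.subgroup_is_group[OF _ group_BijGroup])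
qed


section \<open>Crossed products\<close>

definition factor_set ::
    "('a, 'b) ring_scheme \<Rightarrow> ('a \<Rightarrow> 'a) monoid \<Rightarrow> (('a \<Rightarrow> 'a) \<Rightarrow> ('a \<Rightarrow> 'a) \<Rightarrow> 'a) \<Rightarrow> bool" where
  "factor_set M G a \<longleftrightarrow>
     (\<forall>\<sigma> \<in> carrier G. \<forall>\<tau> \<in> carrier G. a \<sigma> \<tau> \<in> Units M) \<and>
     (\<forall>\<sigma> \<in> carrier G. \<forall>\<tau> \<in> carrier G. \<forall>\<rho> \<in> carrier G.
        a \<sigma> \<tau> \<otimes>\<^bsub>M\<^esub> a (\<sigma> \<otimes>\<^bsub>G\<^esub> \<tau>) \<rho> = a \<sigma> (\<tau> \<otimes>\<^bsub>G\<^esub> \<rho>) \<otimes>\<^bsub>M\<^esub> \<sigma> (a \<tau> \<rho>))"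

text \<open>The formal sum of all \<open>f \<sigma> x\<^sub>\<sigma>\<close> is represented by its coefficient function \<open>f\<close>. The relations
  \<open>x\<^sub>\<sigma> m = \<sigma>(m) x\<^sub>\<sigma>\<close> and \<open>x\<^sub>\<sigma> x\<^sub>\<tau> = a\<^sub>\<sigma>\<^sub>\<tau> x\<^sub>\<sigma>\<^sub>\<tau>\<close> give
  \<open>(f \<sigma> x\<^sub>\<sigma>) (g \<tau> x\<^sub>\<tau>) = f \<sigma> \<sigma>(g \<tau>) a\<^sub>\<sigma>\<^sub>\<tau> x\<^sub>\<sigma>\<^sub>\<tau>\<close>, and the coefficient at \<open>\<rho>\<close> collects the terms
  with \<open>\<tau> = \<sigma>\<inverse>\<rho>\<close>. The factor set need not be normalised, so the copy of \<open>m \<in> M\<close> is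
  \<open>m a\<^sub>1\<^sub>1\<inverse> x\<^sub>1\<close>.\<close>

definition cp_embed ::
    "('a, 'b) ring_scheme \<Rightarrow> ('a \<Rightarrow> 'a) monoid \<Rightarrow> (('a \<Rightarrow> 'a) \<Rightarrow> ('a \<Rightarrow> 'a) \<Rightarrow> 'a) \<Rightarrow>
     'a \<Rightarrow> (('a \<Rightarrow> 'a) \<Rightarrow> 'a)" where
  "cp_embed M G a m =
     (\<lambda>\<rho> \<in> carrier G. if \<rho> = \<one>\<^bsub>G\<^esub> then m \<otimes>\<^bsub>M\<^esub> inv\<^bsub>M\<^esub> (a \<one>\<^bsub>G\<^esub> \<one>\<^bsub>G\<^esub>) else \<zero>\<^bsub>M\<^esub>)"

definition crossed_product ::
    "('a, 'b) ring_scheme \<Rightarrow> ('a \<Rightarrow> 'a) monoid \<Rightarrow> (('a \<Rightarrow> 'a) \<Rightarrow> ('a \<Rightarrow> 'a) \<Rightarrow> 'a) \<Rightarrow>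
     (('a \<Rightarrow> 'a) \<Rightarrow> 'a) ring" where
  "crossed_product M G a =
     \<lparr>carrier = carrier G \<rightarrow>\<^sub>E carrier M,
      mult = \<lambda>f g. \<lambda>\<rho> \<in> carrier G. \<Oplus>\<^bsub>M\<^esub>\<sigma> \<in> carrier G.
        f \<sigma> \<otimes>\<^bsub>M\<^esub> \<sigma> (g (inv\<^bsub>G\<^esub> \<sigma> \<otimes>\<^bsub>G\<^esub> \<rho>)) \<otimes>\<^bsub>M\<^esub> a \<sigma> (inv\<^bsub>G\<^esub> \<sigma> \<otimes>\<^bsub>G\<^esub> \<rho>),
      one = cp_embed M G a \<one>\<^bsub>M\<^esub>,
      zero = \<lambda>\<rho> \<in> carrier G. \<zero>\<^bsub>M\<^esub>,
      add = \<lambda>f g. \<lambda>\<rho> \<in> carrier G. f \<rho> \<oplus>\<^bsub>M\<^esub> g \<rho>\<rparr>"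

text \<open>The map \<open>h\<close> identifies \<open>B\<close> with the crossed product \<open>(M, Gal(M/Z), a)\<close>. Since a crossed product
  contains \<open>M\<close>, the field \<open>M\<close> is taken inside \<open>B\<close> and \<open>h\<close> is required to be the identity
  on it; in particular, \<open>h\<close> is an isomorphism of \<open>Z\<close>-algebras.\<close>

definition crossed_product_iso ::
    "'a set \<Rightarrow> 'a set \<Rightarrow> (('a \<Rightarrow> 'a) \<Rightarrow> ('a \<Rightarrow> 'a) \<Rightarrow> 'a) \<Rightarrow> ('a, 'b) ring_scheme \<Rightarrow>
     ((('a \<Rightarrow> 'a) \<Rightarrow> 'a) \<Rightarrow> 'a) \<Rightarrow> bool" where
  "crossed_product_iso Z M a B h \<longleftrightarrow>
     (let L = B\<lparr>carrier := M\<rparr>; G = aut_group Z L in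
        subfield M B \<and> galois_extension Z L \<and> factor_set L G a \<and>
        h \<in> ring_iso (crossed_product L G a) B \<and>
        (\<forall>m \<in> M. h (cp_embed L G a m) = m))"

definition cyclic_algebra :: "'a set \<Rightarrow> ('a, 'b) ring_scheme \<Rightarrow> nat \<Rightarrow> bool" where
  "cyclic_algebra F A n \<longleftrightarrow>
     (\<exists>M a h. crossed_product_iso F M a A h \<and>
        cyclic_group (aut_group F (A\<lparr>carrier := M\<rparr>)) \<and> ring.dimension A n F M)"


section \<open>The subalgebra attached to a maximal subfield\<close>

definition inducing_family ::
    "('a, 'b) ring_scheme \<Rightarrow> 'a set \<Rightarrow> ('a \<Rightarrow> 'a) monoid \<Rightarrow> (('a \<Rightarrow> 'a) \<Rightarrow> 'a) \<Rightarrow> bool" where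
  "inducing_family A M G x \<longleftrightarrow>
     (\<forall>\<sigma> \<in> carrier G. x \<sigma> \<in> Units A \<and> (\<forall>m \<in> M. x \<sigma> \<otimes>\<^bsub>A\<^esub> m \<otimes>\<^bsub>A\<^esub> inv\<^bsub>A\<^esub> (x \<sigma>) = \<sigma> m))"

definition left_comb ::
    "('a, 'b) ring_scheme \<Rightarrow> ('a \<Rightarrow> 'a) monoid \<Rightarrow> (('a \<Rightarrow> 'a) \<Rightarrow> 'a) \<Rightarrow> (('a \<Rightarrow> 'a) \<Rightarrow> 'a) \<Rightarrow> 'a" where
  "left_comb A G x f = (\<Oplus>\<^bsub>A\<^esub>\<sigma> \<in> carrier G. f \<sigma> \<otimes>\<^bsub>A\<^esub> x \<sigma>)"

text \<open>The left \<open>M\<close>-span of the \<open>x \<sigma>\<close>.\<close>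

definition M_of_G ::
    "('a, 'b) ring_scheme \<Rightarrow> 'a set \<Rightarrow> ('a \<Rightarrow> 'a) monoid \<Rightarrow> (('a \<Rightarrow> 'a) \<Rightarrow> 'a) \<Rightarrow> 'a set" where
  "M_of_G A M G x = left_comb A G x ` (carrier G \<rightarrow>\<^sub>E M)"

end

(* Let D be a division ring with centre Z and M a subfield of finite degree over Z.  Comparing linear
   systems over D gives two bounds: a left spanning family over any ring commuting with M has at least
   [M:Z] members, and, if M is its own centralizer, a left M-independent family has at most [M:Z]
   members.  Both rest on the fact that a shortest nontrivial relation of the form
   "sum of c_j tau_j(m) y_j vanishes for all m" has coefficients intertwining the tau_j.
   For A of degree n and [M:F] = n this shows that M is its own centralizer, and the same argument
   with tau_j in {id, sigma} produces an element inducing a given automorphism sigma of M.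
   The elements x_sigma are left M-independent by the usual Dedekind argument, so M(G) is the crossed
   product; its centre is Fix(G) because M is its own centralizer, and the two bounds applied inside
   M(G) give [M:Fix(G)] = |G|.  In prime degree p, |G| > 1 divides p, whence Fix(G) = F and M(G) = A. *)
theory Submission
  imports Defs
begin

subsection \<open>Linear combinations over subrings\<close>

text \<open>Counting replaces tensor products and double centralizers: one unknown in the division
  ring per member of one family, one equation per member of another. More unknowns than equations
  yield a nontrivial relation. For the upper bound and for inducing elements the equations belong to
  a spanning family of \<open>M\<close> over the centre, and linearity extends the relation to
  \<open>M\<close>; for the lower bound they belong to the family spanning the ring, and the
  relation extends to the ring. If all \<open>\<tau> j\<close> are identities, the coefficients of a
  shortest relation commute with \<open>M\<close>, or with everything, and so lie where independence
  forbids them.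

  The self-centralizing property is the case without slack: an \<open>M\<close>-basis of
  \<open>A\<close> has n^2 / n = n = [M:F] members, so no proper subfamily spans over the
  centralizer.

  The bounds are stated for all division rings, since [M:Fix(G)] = |G| needs them inside M(G), whose
  centre is Fix(G). So M(G) must first be known to be a division ring, and \<open>G\<close> to be
  finite before M(G) is a sum over \<open>G\<close>; the upper bound in \<open>A\<close> supplies
  finiteness.\<close>

definition (in ring) lin_indep :: "'a set \<Rightarrow> 'i set \<Rightarrow> ('i \<Rightarrow> 'a) \<Rightarrow> bool" where
  "lin_indep K J y \<longleftrightarrow>
     (\<forall>c \<in> J \<rightarrow> K. (\<Oplus>j\<in>J. c j \<otimes> y j) = \<zero> \<longrightarrow> (\<forall>j\<in>J. c j = \<zero>))"

text \<open>Both notions use families over an arbitrary index set, since initial segments of the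
  naturals and sets of automorphisms both occur. The coefficient set \<open>K\<close> is arbitrary
  as well: it will be a subfield, the centre, or a centralizer that is not yet known to be
  commutative.\<close>

definition (in ring) lin_span :: "'a set \<Rightarrow> 'i set \<Rightarrow> ('i \<Rightarrow> 'a) \<Rightarrow> 'a set" where
  "lin_span K J y = {(\<Oplus>j\<in>J. c j \<otimes> y j) | c. c \<in> J \<rightarrow> K}"

context ring
begin

section \<open>Finite sums in a ring and in its subrings\<close>

lemma finsum_swap:
  assumes "finite I" "finite J" "\<And>i j. i \<in> I \<Longrightarrow> j \<in> J \<Longrightarrow> f i j \<in> carrier R"
  shows "(\<Oplus>i\<in>I. \<Oplus>j\<in>J. f i j) = (\<Oplus>j\<in>J. \<Oplus>i\<in>I. f i j)"
  using assms(1,3)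
proof (induction I)
  case empty
  then show ?case by (simp add: finsum_zero)
next
  case (insert i I)
  have "(\<Oplus>j\<in>J. \<Oplus>k\<in>insert i I. f k j) = (\<Oplus>j\<in>J. f i j \<oplus> (\<Oplus>k\<in>I. f k j))"
    using insert by (intro finsum_cong') (auto simp: Pi_def)
  also have "\<dots> = (\<Oplus>j\<in>J. f i j) \<oplus> (\<Oplus>j\<in>J. \<Oplus>k\<in>I. f k j)"
    using insert by (intro finsum_addf) (auto simp: Pi_def)
  finally show ?case
    using insert by (simp add: Pi_def)
qed

lemma finsum_remove:
  assumes "finite J" "j \<in> J" "f \<in> J \<rightarrow> carrier R"
  shows "(\<Oplus>i\<in>J. f i) = f j \<oplus> (\<Oplus>i\<in>J - {j}. f i)"
  using finsum_insert[of "J - {j}" j f] assms by (auto simp: insert_absorb Pi_def)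

lemma finsum_single:
  assumes "finite J" "j \<in> J" "f j \<in> carrier R" "\<And>i. i \<in> J \<Longrightarrow> i \<noteq> j \<Longrightarrow> f i = \<zero>"
  shows "(\<Oplus>i\<in>J. f i) = f j"
proof -
  have f: "f \<in> J \<rightarrow> carrier R" using assms by (metis Pi_I zero_closed)
  have "(\<Oplus>i\<in>J - {j}. f i) = (\<Oplus>i\<in>J - {j}. \<zero>)" using assms by (intro finsum_cong') auto
  then show ?thesis using finsum_remove[OF assms(1,2) f] assms(3) by (simp add: finsum_zero)
qed

lemma finsum_minus:
  assumes "f \<in> J \<rightarrow> carrier R" "g \<in> J \<rightarrow> carrier R"
  shows "(\<Oplus>i\<in>J. f i \<ominus> g i) = (\<Oplus>i\<in>J. f i) \<ominus> (\<Oplus>i\<in>J. g i)"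
proof -
  have "(\<Oplus>i\<in>J. f i \<ominus> g i) \<oplus> (\<Oplus>i\<in>J. g i) = (\<Oplus>i\<in>J. f i \<ominus> g i \<oplus> g i)"
    using assms by (intro finsum_addf[symmetric]) auto
  also have "\<dots> = (\<Oplus>i\<in>J. f i)"
    using assms by (intro finsum_cong') (auto simp: minus_eq a_assoc l_neg Pi_def)
  finally have e: "(\<Oplus>i\<in>J. f i \<ominus> g i) \<oplus> (\<Oplus>i\<in>J. g i) = (\<Oplus>i\<in>J. f i)" .
  have "(\<Oplus>i\<in>J. f i \<ominus> g i) \<in> carrier R" "(\<Oplus>i\<in>J. f i) \<in> carrier R" "(\<Oplus>i\<in>J. g i) \<in> carrier R"
    using assms by (auto intro!: finsum_closed)
  then show ?thesis
    using e by (metis a_minus_def add.inv_solve_right)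
qed

lemma finsum_subring_closed:
  assumes "subring S R" "f \<in> J \<rightarrow> S"
  shows "(\<Oplus>i\<in>J. f i) \<in> S"
  using assms(2)
proof (induction J rule: infinite_finite_induct)
  case (insert j J)
  then have "f \<in> J \<rightarrow> carrier R" "f j \<in> carrier R"
    using subringE(1)[OF assms(1)] by auto
  then show ?case using insert subringE(7)[OF assms(1)] by auto
qed (use subringE(2)[OF assms(1)] in auto)

text \<open>\<open>finsum\<close> folds inside the carrier of its structure, so shrinking the
  carrier changes what is being computed. All partial sums stay in \<open>S\<close>, and induction
  gives the same value.\<close>

lemma finsum_consistent:
  assumes "subring S R" "f \<in> J \<rightarrow> S"
  shows "finsum (R\<lparr>carrier := S\<rparr>) f J = finsum R f J"
proof -
  interpret S: ring "R\<lparr>carrier := S\<rparr>" by (rule subring_is_ring[OF assms(1)])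
  show ?thesis using assms(2)
  proof (induction J rule: infinite_finite_induct)
    case (infinite J)
    then show ?case using S.finsum_infinite finsum_infinite by simp
  next
    case empty
    then show ?case using S.finsum_empty finsum_empty by simp
  next
    case (insert j J)
    then have "f \<in> J \<rightarrow> carrier R" "f j \<in> carrier R"
      using subringE(1)[OF assms(1)] by auto
    then show ?case using insert S.finsum_insert[of J j f] by auto
  qed
qed

section \<open>Indexed linear combinations, independence and spans\<close>

lemma lin_comb_subtract:
  assumes "finite J" "c \<in> J \<rightarrow> carrier R" "d \<in> J \<rightarrow> carrier R" "y \<in> J \<rightarrow> carrier R"
  shows "(\<Oplus>j\<in>J. (c j \<ominus> d j) \<otimes> y j) = (\<Oplus>j\<in>J. c j \<otimes> y j) \<ominus> (\<Oplus>j\<in>J. d j \<otimes> y j)"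
proof -
  have "(\<Oplus>j\<in>J. (c j \<ominus> d j) \<otimes> y j) = (\<Oplus>j\<in>J. c j \<otimes> y j \<ominus> d j \<otimes> y j)"
    using assms by (intro finsum_cong') (auto simp: Pi_def minus_eq l_distr l_minus)
  also have "\<dots> = (\<Oplus>j\<in>J. c j \<otimes> y j) \<ominus> (\<Oplus>j\<in>J. d j \<otimes> y j)"
    using assms by (intro finsum_minus) (auto simp: Pi_def)
  finally show ?thesis .
qed

lemma lin_indep_unique:
  assumes "lin_indep K J y" "subring K R" "finite J" "y \<in> J \<rightarrow> carrier R"
    and "c \<in> J \<rightarrow> K" "d \<in> J \<rightarrow> K" "(\<Oplus>j\<in>J. c j \<otimes> y j) = (\<Oplus>j\<in>J. d j \<otimes> y j)" "j \<in> J"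
  shows "c j = d j"
proof -
  have K: "K \<subseteq> carrier R" using subringE(1)[OF assms(2)] .
  then have cd: "c \<in> J \<rightarrow> carrier R" "d \<in> J \<rightarrow> carrier R" using assms by auto
  then have "(\<Oplus>j\<in>J. (c j \<ominus> d j) \<otimes> y j) = \<zero>"
    using lin_comb_subtract[OF assms(3) cd assms(4)] assms(7,4)
    by (simp add: Pi_def minus_eq r_neg)
  moreover have "(\<lambda>j. c j \<ominus> d j) \<in> J \<rightarrow> K"
    using assms(5,6) subringE(5,7)[OF assms(2)] unfolding minus_eq by blast
  ultimately have "\<forall>j\<in>J. c j \<ominus> d j = \<zero>"
    using assms(1)[unfolded lin_indep_def, rule_format, of "\<lambda>j. c j \<ominus> d j"] by blast
  then have "c j \<ominus> d j = \<zero>" using assms(8) by blast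
  then show ?thesis using cd assms(8) by (auto simp: Pi_def r_right_minus_eq)
qed

lemma lin_indepD:
  "lin_indep K J y \<Longrightarrow> c \<in> J \<rightarrow> K \<Longrightarrow> (\<Oplus>j\<in>J. c j \<otimes> y j) = \<zero> \<Longrightarrow> j \<in> J \<Longrightarrow> c j = \<zero>"
  unfolding lin_indep_def by blast

lemma lin_spanI: "c \<in> J \<rightarrow> K \<Longrightarrow> (\<Oplus>j\<in>J. c j \<otimes> y j) \<in> lin_span K J y"
  unfolding lin_span_def by auto

lemma lin_span_insert:
  assumes "finite J" "j \<notin> J" "K \<subseteq> carrier R" "y \<in> insert j J \<rightarrow> carrier R"
  shows "lin_span K (insert j J) y = line_extension K (y j) (lin_span K J y)"
proof (intro Set.set_eqI iffI)
  fix v assume "v \<in> lin_span K (insert j J) y"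
  then obtain c where c: "c \<in> insert j J \<rightarrow> K" "v = (\<Oplus>i\<in>insert j J. c i \<otimes> y i)"
    unfolding lin_span_def by blast
  have "(\<Oplus>i\<in>insert j J. c i \<otimes> y i) = c j \<otimes> y j \<oplus> (\<Oplus>i\<in>J. c i \<otimes> y i)"
    using assms c(1) by (intro finsum_insert) (auto simp: Pi_def subset_eq)
  then show "v \<in> line_extension K (y j) (lin_span K J y)"
    using c unfolding line_extension_mem_iff lin_span_def by auto
next
  fix v assume "v \<in> line_extension K (y j) (lin_span K J y)"
  then obtain k c where c: "k \<in> K" "c \<in> J \<rightarrow> K" "v = k \<otimes> y j \<oplus> (\<Oplus>i\<in>J. c i \<otimes> y i)"
    unfolding line_extension_mem_iff lin_span_def by blast
  let ?c = "c(j := k)"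
  have "(\<Oplus>i\<in>insert j J. ?c i \<otimes> y i) = ?c j \<otimes> y j \<oplus> (\<Oplus>i\<in>J. ?c i \<otimes> y i)"
    using assms c by (intro finsum_insert) (auto simp: Pi_def subset_eq)
  also have "(\<Oplus>i\<in>J. ?c i \<otimes> y i) = (\<Oplus>i\<in>J. c i \<otimes> y i)"
    using assms c by (intro finsum_cong') (auto simp: Pi_def subset_eq)
  finally show "v \<in> lin_span K (insert j J) y"
    using c assms(2) unfolding lin_span_def by (auto intro!: exI[of _ ?c])
qed

lemma lin_span_empty: "lin_span K {} y = {\<zero>}"
  unfolding lin_span_def by auto

lemma lin_span_base:
  assumes "subring K R" "finite J" "y \<in> J \<rightarrow> carrier R" "j \<in> J"
  shows "y j \<in> lin_span K J y"
proof -
  let ?c = "\<lambda>i. if i = j then \<one> else \<zero>"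
  have "(\<Oplus>i\<in>J. ?c i \<otimes> y i) = ?c j \<otimes> y j"
    using assms by (intro finsum_single) (auto simp: Pi_def)
  moreover have "?c \<in> J \<rightarrow> K" using subringE(2,3)[OF assms(1)] by auto
  moreover have "?c j \<otimes> y j = y j" using funcset_mem[OF assms(3,4)] by simp
  ultimately show ?thesis unfolding lin_span_def by force
qed

text \<open>A relation with a nonzero coefficient at \<open>j\<close> can be solved for
  \<open>y j\<close>, by inverting in \<open>K\<close>. The split mirrors the step from
  \<open>E\<close> to \<open>line_extension K v E\<close> in the inductive definition of
  \<open>dimension\<close>.\<close>

lemma lin_indep_insert:
  assumes K: "subfield K R" and fin: "finite J" "j \<notin> J" and y: "y \<in> insert j J \<rightarrow> carrier R"
  shows "lin_indep K (insert j J) y \<longleftrightarrow> lin_indep K J y \<and> y j \<notin> lin_span K J y"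
proof (intro iffI conjI)
  note KC = subfieldE(3)[OF K]
  note KS = subringE[OF subfieldE(1)[OF K]]
  have split: "(\<Oplus>i\<in>insert j J. c i \<otimes> y i) = c j \<otimes> y j \<oplus> (\<Oplus>i\<in>J. c i \<otimes> y i)"
    if "c \<in> insert j J \<rightarrow> K" for c
    using that fin KC y by (intro finsum_insert) (auto simp: Pi_def subset_eq)
  have upd: "(\<Oplus>i\<in>J. (c(j := k)) i \<otimes> y i) = (\<Oplus>i\<in>J. c i \<otimes> y i)" if "c \<in> J \<rightarrow> K" for c k
    using that fin y KC by (intro finsum_cong') (auto simp: Pi_def subset_eq)
  {
    assume I: "lin_indep K (insert j J) y"
    show "lin_indep K J y" unfolding lin_indep_def
    proof (intro ballI impI)
      fix c i assume c: "c \<in> J \<rightarrow> K" "(\<Oplus>j\<in>J. c j \<otimes> y j) = \<zero>" "i \<in> J"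
      have c': "c(j := \<zero>) \<in> insert j J \<rightarrow> K" using c KS(2) by auto
      have "(\<Oplus>i\<in>insert j J. (c(j := \<zero>)) i \<otimes> y i) = \<zero>"
        unfolding split[OF c'] upd[OF c(1)] using c y by auto
      then have "(c(j := \<zero>)) i = \<zero>" using I c' c(3) unfolding lin_indep_def by blast
      then show "c i = \<zero>" using c(3) fin(2) by (auto split: if_splits)
    qed
    show "y j \<notin> lin_span K J y"
    proof
      assume "y j \<in> lin_span K J y"
      then obtain c where c: "c \<in> J \<rightarrow> K" "y j = (\<Oplus>i\<in>J. c i \<otimes> y i)"
        unfolding lin_span_def by blast
      have c': "c(j := \<ominus> \<one>) \<in> insert j J \<rightarrow> K" using c KS(3,5) by auto
      have "(\<Oplus>i\<in>insert j J. (c(j := \<ominus> \<one>)) i \<otimes> y i) = \<zero>"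
        unfolding split[OF c'] upd[OF c(1)] c(2)[symmetric] using y by (auto simp: l_minus l_neg)
      then have "(c(j := \<ominus> \<one>)) j = \<zero>" using I c' unfolding lin_indep_def by blast
      then show False using subfieldE(6)[OF K] by (metis fun_upd_same minus_minus minus_zero one_closed)
    qed
  }
  assume A: "lin_indep K J y \<and> y j \<notin> lin_span K J y"
  show "lin_indep K (insert j J) y" unfolding lin_indep_def
  proof (rule ballI, rule impI)
    fix c assume c: "c \<in> insert j J \<rightarrow> K" "(\<Oplus>j\<in>insert j J. c j \<otimes> y j) = \<zero>"
    have cC: "c \<in> insert j J \<rightarrow> carrier R" using c KC by auto
    have sC: "(\<Oplus>i\<in>J. c i \<otimes> y i) \<in> carrier R"
      using cC y by (intro finsum_closed) (auto simp: Pi_def)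
    have cj: "c j = \<zero>"
    proof (rule ccontr)
      assume "c j \<noteq> \<zero>"
      then have k: "c j \<in> K - {\<zero>}" using c by auto
      note inv = subfield_m_inv[OF K k]
      have e: "c j \<otimes> y j = \<ominus> (\<Oplus>i\<in>J. c i \<otimes> y i)"
        using c(2) split[OF c(1)] sC cC y by (simp add: Pi_def minus_equality)
      have "y j = inv (c j) \<otimes> (c j \<otimes> y j)"
        using inv cC y KC by (auto simp: Pi_def m_assoc[symmetric] subset_eq)
      also have "\<dots> = (\<ominus> (inv (c j))) \<otimes> (\<Oplus>i\<in>J. c i \<otimes> y i)"
        unfolding e using inv(1) sC KC by (simp add: l_minus r_minus subset_eq)
      also have "\<dots> = (\<Oplus>i\<in>J. (\<ominus> (inv (c j))) \<otimes> (c i \<otimes> y i))"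
        using inv(1) KC cC y fin by (intro finsum_rdistr) (auto simp: Pi_def subset_eq)
      also have "\<dots> = (\<Oplus>i\<in>J. ((\<ominus> (inv (c j))) \<otimes> c i) \<otimes> y i)"
        using inv(1) KC cC y fin by (intro finsum_cong') (auto simp: Pi_def subset_eq m_assoc)
      finally have "y j \<in> lin_span K J y" unfolding lin_span_def
        using inv(1) KS c(1) by (auto simp: Pi_def intro!: exI[of _ "\<lambda>i. (\<ominus> (inv (c j))) \<otimes> c i"])
      then show False using A by blast
    qed
    then have "(\<Oplus>i\<in>J. c i \<otimes> y i) = \<zero>"
      using c(2) split[OF c(1)] sC y by auto
    moreover have "c \<in> J \<rightarrow> K" using c by auto
    ultimately show "\<forall>j\<in>insert j J. c j = \<zero>"
      using A cj unfolding lin_indep_def by blast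
  qed
qed

section \<open>Indexed bases and dimension\<close>

lemma dimension_lin_span:
  assumes "subfield K R" "finite J" "y \<in> J \<rightarrow> carrier R" "lin_indep K J y"
  shows "dimension (card J) K (lin_span K J y)"
  using assms(2-4)
proof (induction J)
  case empty
  then show ?case by (simp add: lin_span_empty)
next
  case (insert j J)
  then show ?case
    using lin_indep_insert[OF assms(1), of J j y] lin_span_insert[of J j K y]
      subfieldE(3)[OF assms(1)] Suc_dim[of "y j"] by auto
qed

text \<open>Each step of the induction places the new vector at index \<open>n\<close>, which leaves
  all sums over the earlier indices unchanged.\<close>

lemma dimension_basis:
  assumes "subfield K R" "dimension n K E"
  obtains y where "y \<in> {..<n} \<rightarrow> carrier R" "lin_indep K {..<n} y" "E = lin_span K {..<n::nat} y"
proof -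
  have "\<exists>y. y \<in> {..<n} \<rightarrow> carrier R \<and> lin_indep K {..<n} y \<and> E = lin_span K {..<n} y"
    using assms(2,1)
  proof (induction rule: dimension.induct)
    case (zero_dim K)
    then show ?case by (simp add: lin_span_empty) (simp add: lin_indep_def)
  next
    case (Suc_dim v E n K)
    obtain y where y: "y \<in> {..<n} \<rightarrow> carrier R" "lin_indep K {..<n} y" "E = lin_span K {..<n} y"
      using Suc_dim.IH[OF Suc_dim.prems] by blast
    let ?y = "y(n := v)"
    have KC: "K \<subseteq> carrier R" using subfieldE(3)[OF Suc_dim.prems] .
    have yC: "?y \<in> insert n {..<n} \<rightarrow> carrier R" using y Suc_dim by auto
    have eq: "(\<Oplus>i\<in>{..<n}. c i \<otimes> ?y i) = (\<Oplus>i\<in>{..<n}. c i \<otimes> y i)" if "c \<in> {..<n} \<rightarrow> K" for c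
      using that KC y(1) by (intro finsum_cong') (auto simp: Pi_def subset_eq)
    have sp: "lin_span K {..<n} ?y = E"
      unfolding y(3) lin_span_def using eq by (metis (no_types, lifting))
    have "lin_indep K {..<n} ?y"
      using y(2) eq unfolding lin_indep_def by simp
    then have "lin_indep K (insert n {..<n}) ?y"
      using lin_indep_insert[OF Suc_dim.prems _ _ yC] sp Suc_dim(2) by simp
    moreover have "line_extension K v E = lin_span K (insert n {..<n}) ?y"
      using lin_span_insert[OF _ _ KC yC] sp by simp
    ultimately show ?case using yC by (metis lessThan_Suc)
  qed
  then show ?thesis using that by blast
qed

text \<open>Without independence, a new member either lies in the span already reached and changes
  nothing, or raises the dimension by one.\<close>

lemma finite_dimension_lin_span:
  assumes "subfield K R" "finite J" "y \<in> J \<rightarrow> carrier R"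
  shows "\<exists>n. dimension n K (lin_span K J y)"
  using assms(2,3)
proof (induction J)
  case empty
  then show ?case by (metis lin_span_empty zero_dim)
next
  case (insert j J)
  then obtain n where n: "dimension n K (lin_span K J y)" by auto
  have e: "lin_span K (insert j J) y = line_extension K (y j) (lin_span K J y)"
    using insert lin_span_insert[of J j K y] subfieldE(3)[OF assms(1)] by auto
  show ?case
  proof (cases "y j \<in> lin_span K J y")
    case True
    note P = space_subgroup_props[OF assms(1) n]
    have "line_extension K (y j) (lin_span K J y) = lin_span K J y"
    proof (intro Set.set_eqI iffI)
      fix v assume "v \<in> lin_span K J y"
      moreover have "\<zero> \<otimes> y j \<oplus> v = v" using calculation P(1) insert by auto
      ultimately show "v \<in> line_extension K (y j) (lin_span K J y)"
        unfolding line_extension_mem_iff using subringE(2)[OF subfieldE(1)[OF assms(1)]] by force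
    qed (use P True in \<open>auto simp: line_extension_mem_iff\<close>)
    then show ?thesis using n e by metis
  next
    case False
    then show ?thesis using e Suc_dim[OF _ False n] insert by auto
  qed
qed

text \<open>A \<open>K\<close>-basis of \<open>E\<close> still spans over \<open>L\<close>, although
  it may become dependent there; closure of \<open>E\<close> under \<open>L\<close> keeps the larger
  span inside \<open>E\<close>.\<close>

lemma finite_dimension_larger_field:
  assumes K: "subfield K R" and L: "subfield L R" and "K \<subseteq> L" and d: "finite_dimension K E"
    and closed: "subring E R" "\<And>l v. l \<in> L \<Longrightarrow> v \<in> E \<Longrightarrow> l \<otimes> v \<in> E"
  shows "finite_dimension L E"
proof -
  obtain n where "dimension n K E" using d by blast
  then obtain y where y: "y \<in> {..<n} \<rightarrow> carrier R" "lin_indep K {..<n} y" "E = lin_span K {..<n} y"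
    using dimension_basis[OF K] by blast
  have yE: "y i \<in> E" if "i < n" for i
    using that lin_span_base[OF subfieldE(1)[OF K] _ y(1)] y(3) by auto
  have "E \<subseteq> lin_span L {..<n} y"
    using assms(3) unfolding y(3) lin_span_def by blast
  moreover have "lin_span L {..<n} y \<subseteq> E"
    unfolding lin_span_def using yE closed
    by (auto intro!: finsum_subring_closed)
  ultimately show ?thesis
    using finite_dimension_lin_span[OF L _ y(1)] finite_dimension_def by (metis finite_lessThan subset_antisym)
qed

text \<open>The rules for \<open>dimension\<close> demand each new vector in the carrier, now
  \<open>S\<close>. This is recovered from the final space, because
  \<open>line_extension K v E\<close> contains both \<open>v\<close> and \<open>E\<close>.\<close>

lemma dimension_consistent:
  assumes S: "subring S R" and KS: "K \<subseteq> S" and K: "subfield K R" and "dimension n K E" "E \<subseteq> S"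
  shows "ring.dimension (R\<lparr>carrier := S\<rparr>) n K E"
proof -
  interpret S: ring "R\<lparr>carrier := S\<rparr>" by (rule subring_is_ring[OF S])
  show ?thesis using assms(4,5) K KS
  proof (induction rule: dimension.induct)
    case (zero_dim K)
    then show ?case using S.zero_dim by simp
  next
    case (Suc_dim v E n K)
    note P = space_subgroup_props[OF Suc_dim(6,3)]
    note KR = subringE[OF subfieldE(1)[OF Suc_dim(6)]]
    have "E \<subseteq> line_extension K v E"
    proof
      fix u assume "u \<in> E"
      moreover have "\<zero> \<otimes> v \<oplus> u = u" using calculation P(1) Suc_dim by auto
      ultimately show "u \<in> line_extension K v E"
        unfolding line_extension_mem_iff using KR(2) by force
    qed
    moreover have "v \<in> line_extension K v E"
    proof -
      have "v = \<one> \<otimes> v \<oplus> \<zero>" using Suc_dim by auto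
      then show ?thesis unfolding line_extension_mem_iff using KR(3) P(2) by blast
    qed
    ultimately have "v \<in> S" "E \<subseteq> S" using Suc_dim by auto
    then show ?case
      using S.Suc_dim[of v E n K] Suc_dim line_extension_consistent[OF S] by simp
  qed
qed

end

subsection \<open>Division rings\<close>

text \<open>The equation excludes the zero ring, as \<open>\<one>\<close> is always a unit. A locale
  is convenient because the same facts are needed for \<open>A\<close>, for opposite rings and for
  the subrings \<open>M\<close> and M(G).\<close>

locale skew_field = ring R for R (structure) +
  assumes units: "Units R = carrier R - {\<zero>}"

context skew_field
begin

lemma inv_nonzero:
  assumes "a \<in> carrier R" "a \<noteq> \<zero>"
  shows "inv a \<in> carrier R" "inv a \<otimes> a = \<one>" "a \<otimes> inv a = \<one>"
  using assms units by auto

lemma one_nonzero: "\<one> \<noteq> \<zero>"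
  using units Units_one_closed by auto

lemma integral_skew:
  assumes "a \<otimes> b = \<zero>" "a \<in> carrier R" "b \<in> carrier R"
  shows "a = \<zero> \<or> b = \<zero>"
proof (rule ccontr)
  assume "\<not> ?thesis"
  then have "a \<otimes> b \<in> Units R" using assms units Units_m_closed[of a b] by auto
  then show False using assms units by auto
qed

text \<open>Gaussian elimination with the unknowns on the left of the coefficients. From every other
  equation a right multiple of equation \<open>j\<close> is subtracted so as to remove the unknown
  at a pivot \<open>i0\<close>; one equation and one unknown disappear.\<close>

lemma homogeneous_system:
  assumes "finite J" "finite I" "card J < card I"
    and "\<And>i j. i \<in> I \<Longrightarrow> j \<in> J \<Longrightarrow> P i j \<in> carrier R"
  shows "\<exists>c. c \<in> I \<rightarrow> carrier R \<and> (\<exists>i\<in>I. c i \<noteq> \<zero>) \<and> (\<forall>j\<in>J. (\<Oplus>i\<in>I. c i \<otimes> P i j) = \<zero>)"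
  using assms
proof (induction J arbitrary: I P rule: finite_induct)
  case empty
  then have "I \<noteq> {}" by auto
  then show ?case using one_nonzero by (intro exI[of _ "\<lambda>_. \<one>"]) auto
next
  case (insert j J)
  show ?case
  proof (cases "\<forall>i\<in>I. P i j = \<zero>")
    case True
    obtain c where c: "c \<in> I \<rightarrow> carrier R" "\<exists>i\<in>I. c i \<noteq> \<zero>"
        "\<forall>k\<in>J. (\<Oplus>i\<in>I. c i \<otimes> P i k) = \<zero>"
      using insert.IH[of I P] insert.prems insert.hyps by auto
    have "(\<Oplus>i\<in>I. c i \<otimes> P i j) = (\<Oplus>i\<in>I. \<zero>)"
      using True c(1) by (intro finsum_cong') (auto simp: Pi_def)
    then show ?thesis using c by (intro exI[of _ c]) (auto simp: finsum_zero)
  next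
    case False
    then obtain i0 where i0: "i0 \<in> I" "P i0 j \<noteq> \<zero>" by blast
    define q where "q = inv (P i0 j)"
    have P0: "P i0 k \<in> carrier R" if "k \<in> insert j J" for k using i0 insert.prems(3) that by auto
    have q: "q \<in> carrier R" "q \<otimes> P i0 j = \<one>"
      using inv_nonzero[OF P0 i0(2)] unfolding q_def by auto
    define P' where "P' = (\<lambda>i k. P i k \<ominus> P i j \<otimes> q \<otimes> P i0 k)"
    have P': "P' i k \<in> carrier R" if "i \<in> I - {i0}" "k \<in> J" for i k
      using that insert.prems(3) P0 q unfolding P'_def by auto
    have "card J < card (I - {i0})"
      using insert i0 by simp
    then obtain c where c: "c \<in> I - {i0} \<rightarrow> carrier R" "\<exists>i\<in>I - {i0}. c i \<noteq> \<zero>"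
        "\<forall>k\<in>J. (\<Oplus>i\<in>I - {i0}. c i \<otimes> P' i k) = \<zero>"
      using insert.IH[of "I - {i0}" P'] insert.prems P' by blast
    define s where "s = (\<Oplus>i\<in>I - {i0}. c i \<otimes> P i j)"
    have s: "s \<in> carrier R"
      unfolding s_def using c insert.prems(3) by (auto intro!: finsum_closed)
    \<comment> \<open>Equation \<open>j\<close> forces this value at \<open>i0\<close>: the term
      \<open>d i0 \<otimes> P i0 j\<close> has to cancel \<open>s\<close>.\<close>
    define d where "d = c(i0 := \<ominus> (s \<otimes> q))"
    have dC: "d \<in> I \<rightarrow> carrier R" unfolding d_def using c(1) s q by auto
    have *: "(\<Oplus>i\<in>I. d i \<otimes> P i k) = \<ominus> (s \<otimes> q) \<otimes> P i0 k \<oplus> (\<Oplus>i\<in>I - {i0}. c i \<otimes> P i k)"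
      if k: "k \<in> insert j J" for k
    proof -
      have "(\<Oplus>i\<in>I. d i \<otimes> P i k) = d i0 \<otimes> P i0 k \<oplus> (\<Oplus>i\<in>I - {i0}. d i \<otimes> P i k)"
        using insert.prems i0 dC k by (intro finsum_remove) auto
      also have "(\<Oplus>i\<in>I - {i0}. d i \<otimes> P i k) = (\<Oplus>i\<in>I - {i0}. c i \<otimes> P i k)"
        using c insert.prems(3) k by (intro finsum_cong') (auto simp: d_def)
      finally show ?thesis by (simp add: d_def)
    qed
    have "(\<Oplus>i\<in>I. d i \<otimes> P i k) = \<zero>" if k: "k \<in> insert j J" for k
    proof (cases "k = j")
      case True
      have "\<ominus> (s \<otimes> q) \<otimes> P i0 j = \<ominus> s"
        using s q P0[of j] by (simp add: l_minus m_assoc)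
      then show ?thesis
        using *[OF k] s True by (simp add: s_def[symmetric] l_neg)
    next
      case False
      then have kJ: "k \<in> J" using k by auto
      have pc: "P i k \<in> carrier R" "P i j \<in> carrier R" if "i \<in> I" for i
        using that k insert.prems(3) by auto
      have "\<zero> = (\<Oplus>i\<in>I - {i0}. c i \<otimes> P' i k)" using c kJ by auto
      also have "\<dots> = (\<Oplus>i\<in>I - {i0}. c i \<otimes> P i k \<ominus> c i \<otimes> P i j \<otimes> (q \<otimes> P i0 k))"
        using c pc P0[OF k] q
        by (intro finsum_cong') (auto simp: P'_def minus_eq r_distr r_minus m_assoc Pi_def)
      also have "\<dots> = (\<Oplus>i\<in>I - {i0}. c i \<otimes> P i k) \<ominus> (\<Oplus>i\<in>I - {i0}. c i \<otimes> P i j \<otimes> (q \<otimes> P i0 k))"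
        using c pc P0[OF k] q by (intro finsum_minus) (auto simp: Pi_def)
      also have "(\<Oplus>i\<in>I - {i0}. c i \<otimes> P i j \<otimes> (q \<otimes> P i0 k)) = s \<otimes> (q \<otimes> P i0 k)"
        unfolding s_def using c pc P0[OF k] q insert.prems(1)
        by (intro finsum_ldistr[symmetric]) (auto simp: Pi_def)
      finally have **: "(\<Oplus>i\<in>I - {i0}. c i \<otimes> P i k) \<ominus> s \<otimes> (q \<otimes> P i0 k) = \<zero>" by simp
      have tC: "(\<Oplus>i\<in>I - {i0}. c i \<otimes> P i k) \<in> carrier R"
        using c pc by (auto intro!: finsum_closed)
      have "\<ominus> (s \<otimes> q) \<otimes> P i0 k = \<ominus> (s \<otimes> (q \<otimes> P i0 k))"
        using s q P0[OF k] by (simp add: l_minus m_assoc)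
      then show ?thesis
        using *[OF k] ** tC s q P0[OF k] by (simp add: minus_eq a_comm)
    qed
    then show ?thesis
      using dC c(2) unfolding d_def by (intro exI[of _ d]) (auto simp: d_def split: if_splits)
  qed
qed

text \<open>The shortest nontrivial relation is rigid: normalising one coefficient and comparing the
  relations at \<open>m n\<close> and \<open>m\<close> produces a shorter one.\<close>

lemma shortest_relation:
  assumes "finite J" "y \<in> J \<rightarrow> carrier R"
    and D: "subring D R" "\<And>a. a \<in> D \<Longrightarrow> a \<noteq> \<zero> \<Longrightarrow> inv a \<in> D"
    and \<tau>D: "\<And>j m. j \<in> J \<Longrightarrow> m \<in> M \<Longrightarrow> \<tau> j m \<in> D"
    and \<tau>mult: "\<And>j m n. j \<in> J \<Longrightarrow> m \<in> M \<Longrightarrow> n \<in> M \<Longrightarrow> \<tau> j (m \<otimes> n) = \<tau> j m \<otimes> \<tau> j n"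
    and M: "\<And>m n. m \<in> M \<Longrightarrow> n \<in> M \<Longrightarrow> m \<otimes> n \<in> M"
    and c: "c \<in> J \<rightarrow> D" "\<exists>j\<in>J. c j \<noteq> \<zero>"
      "\<And>m. m \<in> M \<Longrightarrow> (\<Oplus>j\<in>J. c j \<otimes> (\<tau> j m \<otimes> y j)) = \<zero>"
  obtains d i where "d \<in> J \<rightarrow> D" "i \<in> J" "d i = \<one>"
    "\<And>m. m \<in> M \<Longrightarrow> (\<Oplus>j\<in>J. d j \<otimes> (\<tau> j m \<otimes> y j)) = \<zero>"
    "\<And>j m. j \<in> J \<Longrightarrow> m \<in> M \<Longrightarrow> d j \<otimes> \<tau> j m = \<tau> i m \<otimes> d j"
proof -
  note DS = subringE[OF D(1)]
  have \<tau>C: "\<tau> j m \<in> carrier R" if "j \<in> J" "m \<in> M" for j m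
    using \<tau>D[OF that] DS(1) by blast
  let ?rel = "\<lambda>c. c \<in> J \<rightarrow> D \<and> (\<exists>j\<in>J. c j \<noteq> \<zero>) \<and>
    (\<forall>m\<in>M. (\<Oplus>j\<in>J. c j \<otimes> (\<tau> j m \<otimes> y j)) = \<zero>)"
  let ?supp = "\<lambda>c. {j \<in> J. c j \<noteq> \<zero>}"
  have "?rel c" using c by blast
  then obtain b where b: "?rel b" and min: "\<And>d. ?rel d \<Longrightarrow> card (?supp b) \<le> card (?supp d)"
    using ex_has_least_nat[of ?rel c "\<lambda>c. card (?supp c)"] by blast
  have ty: "\<tau> j m \<otimes> y j \<in> carrier R" if "j \<in> J" "m \<in> M" for j m
    using that \<tau>C assms(2) by auto
  obtain i where i: "i \<in> J" "b i \<noteq> \<zero>" using b by blast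
  have bD: "b j \<in> D" if "j \<in> J" for j using b that by auto
  then have bC: "b j \<in> carrier R" if "j \<in> J" for j using that DS(1) by blast
  define q where "q = inv (b i)"
  have q: "q \<in> carrier R" "q \<otimes> b i = \<one>" using inv_nonzero[OF bC i(2)] i unfolding q_def by auto
  define d where "d = (\<lambda>j. q \<otimes> b j)"
  \<comment> \<open>Normalising must not leave \<open>D\<close>. The applications take the whole
    ring for \<open>D\<close>, except in the independence of inducing elements, where the
    coefficients have to stay in \<open>M\<close>.\<close>
  have qD: "q \<in> D" using D(2)[OF bD] i unfolding q_def by blast
  have dD: "d j \<in> D" if "j \<in> J" for j using DS(6)[OF qD bD[OF that]] unfolding d_def .
  then have dC: "d j \<in> carrier R" if "j \<in> J" for j using that DS(1) by blast
  have di: "d i = \<one>" using q unfolding d_def by simp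
  have drel: "(\<Oplus>j\<in>J. d j \<otimes> (\<tau> j m \<otimes> y j)) = \<zero>" if m: "m \<in> M" for m
  proof -
    have "(\<Oplus>j\<in>J. d j \<otimes> (\<tau> j m \<otimes> y j)) = (\<Oplus>j\<in>J. q \<otimes> (b j \<otimes> (\<tau> j m \<otimes> y j)))"
      using q bC ty m by (intro finsum_cong') (auto simp: d_def m_assoc)
    also have "\<dots> = q \<otimes> (\<Oplus>j\<in>J. b j \<otimes> (\<tau> j m \<otimes> y j))"
      using q bC ty m assms(1) by (intro finsum_rdistr[symmetric]) auto
    finally show ?thesis using b m q by simp
  qed
  have "d j \<otimes> \<tau> j n = \<tau> i n \<otimes> d j" if j: "j \<in> J" and n: "n \<in> M" for j n
  proof -
    \<comment> \<open>Subtracting \<open>\<tau> i n\<close> times the relation at \<open>m\<close>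
      from the relation at \<open>n \<otimes> m\<close> cancels the coefficient at \<open>i\<close>,
      where \<open>d i = \<one>\<close>, and creates none where \<open>b\<close> vanishes.
      Minimality makes \<open>e\<close> vanish on \<open>J\<close>, which is the intertwining
      identity.\<close>
    define e where "e = (\<lambda>j. d j \<otimes> \<tau> j n \<ominus> \<tau> i n \<otimes> d j)"
    have eD: "e j \<in> D" if "j \<in> J" for j
      using that dD \<tau>D[OF _ n] i(1) DS(5-7) unfolding e_def minus_eq by auto
    have erel: "(\<Oplus>j\<in>J. e j \<otimes> (\<tau> j m \<otimes> y j)) = \<zero>" if m: "m \<in> M" for m
    proof -
      have "(\<Oplus>j\<in>J. e j \<otimes> (\<tau> j m \<otimes> y j))
          = (\<Oplus>j\<in>J. d j \<otimes> (\<tau> j (n \<otimes> m) \<otimes> y j) \<ominus> \<tau> i n \<otimes> (d j \<otimes> (\<tau> j m \<otimes> y j)))"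
        using dC \<tau>C m n i(1) assms(2) M \<tau>mult
        by (intro finsum_cong') (auto simp: e_def minus_eq l_distr l_minus m_assoc Pi_def)
      also have "\<dots> = (\<Oplus>j\<in>J. d j \<otimes> (\<tau> j (n \<otimes> m) \<otimes> y j))
          \<ominus> (\<Oplus>j\<in>J. \<tau> i n \<otimes> (d j \<otimes> (\<tau> j m \<otimes> y j)))"
        using dC ty m n M \<tau>C i(1) by (intro finsum_minus) auto
      also have "(\<Oplus>j\<in>J. \<tau> i n \<otimes> (d j \<otimes> (\<tau> j m \<otimes> y j)))
          = \<tau> i n \<otimes> (\<Oplus>j\<in>J. d j \<otimes> (\<tau> j m \<otimes> y j))"
        using dC ty m n \<tau>C i(1) assms(1) by (intro finsum_rdistr[symmetric]) auto
      finally show ?thesis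
        using drel[OF m] drel[OF M[OF n m]] \<tau>C[OF i(1) n] by (simp add: minus_eq)
    qed
    have "e i = \<zero>" using di \<tau>C[OF i(1) n] unfolding e_def by (simp add: minus_eq r_neg)
    moreover have "e j = \<zero>" if "j \<in> J" "b j = \<zero>" for j
      using that q \<tau>C[OF _ n] i(1) unfolding e_def d_def by (simp add: minus_eq)
    ultimately have "?supp e \<subset> ?supp b" using i by blast
    then have "card (?supp e) < card (?supp b)" using assms(1) by (intro psubset_card_mono) auto
    then have "\<not> ?rel e" using min[of e] by linarith
    then have "e j = \<zero>" using eD erel j by blast
    then show ?thesis
      using dC[OF j] \<tau>C[OF j n] \<tau>C[OF i(1) n] unfolding e_def by simp
  qed
  then show ?thesis using that[of d i] dD i(1) di drel by blast
qed

text \<open>With fewer \<open>y j\<close> than \<open>e i\<close>, a nontrivial \<open>a\<close>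
  makes the sum over \<open>i\<close> of \<open>a i \<otimes> (y j \<otimes> e i)\<close> vanish for
  every \<open>j\<close>. In an expansion of \<open>x\<close> the coefficients \<open>c j\<close>
  stand on the right and commute with the \<open>e i\<close>, so they leave the sum and the same
  relation holds with any \<open>x\<close> for \<open>y j\<close>. A shortest such relation has
  central coefficients, and \<open>x = \<one>\<close> contradicts independence.\<close>

lemma card_le_of_right_spanning:
  assumes fin: "finite I" "finite J" and e: "e \<in> I \<rightarrow> carrier R" and y: "y \<in> J \<rightarrow> carrier R"
    and indep: "lin_indep (ring_center R) I e"
    and C: "C \<subseteq> carrier R" "\<And>i c. i \<in> I \<Longrightarrow> c \<in> C \<Longrightarrow> c \<otimes> e i = e i \<otimes> c"
    and spans: "\<And>x. x \<in> carrier R \<Longrightarrow> \<exists>c \<in> J \<rightarrow> C. x = (\<Oplus>j\<in>J. y j \<otimes> c j)"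
  shows "card I \<le> card J"
proof (rule ccontr)
  assume "\<not> ?thesis"
  then have "card J < card I" by simp
  then obtain a where a: "a \<in> I \<rightarrow> carrier R" "\<exists>i\<in>I. a i \<noteq> \<zero>"
      "\<forall>j\<in>J. (\<Oplus>i\<in>I. a i \<otimes> (y j \<otimes> e i)) = \<zero>"
    using homogeneous_system[OF fin(2,1), of "\<lambda>i j. y j \<otimes> e i"] e y by (auto simp: Pi_def)
  have eC: "e i \<in> carrier R" if "i \<in> I" for i using e that by auto
  have yC: "y i \<in> carrier R" if "i \<in> J" for i using y that by auto
  have aC: "a i \<in> carrier R" if "i \<in> I" for i using a that by auto
  have van: "(\<Oplus>i\<in>I. a i \<otimes> (x \<otimes> e i)) = \<zero>" if x: "x \<in> carrier R" for x
  proof -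
    obtain c where c: "c \<in> J \<rightarrow> C" "x = (\<Oplus>j\<in>J. y j \<otimes> c j)" using spans[OF x] by blast
    have cC: "c j \<in> carrier R" "c j \<in> C" if "j \<in> J" for j using c C(1) that by auto
    have "(\<Oplus>i\<in>I. a i \<otimes> (x \<otimes> e i)) = (\<Oplus>i\<in>I. \<Oplus>j\<in>J. a i \<otimes> (y j \<otimes> e i) \<otimes> c j)"
    proof (intro finsum_cong')
      fix i assume i: "i \<in> I"
      have "a i \<otimes> (x \<otimes> e i) = (\<Oplus>j\<in>J. a i \<otimes> (y j \<otimes> c j \<otimes> e i))"
        unfolding c(2) using aC eC yC cC i fin
        by (subst finsum_ldistr; (subst finsum_rdistr)?) auto
      also have "\<dots> = (\<Oplus>j\<in>J. a i \<otimes> (y j \<otimes> e i) \<otimes> c j)"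
        using aC eC yC cC i C(2) by (intro finsum_cong') (auto simp: m_assoc)
      finally show "a i \<otimes> (x \<otimes> e i) = (\<Oplus>j\<in>J. a i \<otimes> (y j \<otimes> e i) \<otimes> c j)" .
    qed (use aC eC yC cC in \<open>auto intro!: finsum_closed\<close>)
    also have "\<dots> = (\<Oplus>j\<in>J. \<Oplus>i\<in>I. a i \<otimes> (y j \<otimes> e i) \<otimes> c j)"
      using aC eC yC cC fin by (intro finsum_swap) auto
    also have "\<dots> = (\<Oplus>j\<in>J. (\<Oplus>i\<in>I. a i \<otimes> (y j \<otimes> e i)) \<otimes> c j)"
      using aC eC yC cC fin by (intro finsum_cong' finsum_ldistr[symmetric]) auto
    also have "\<dots> = (\<Oplus>j\<in>J. \<zero>)"
      using a(3) cC by (intro finsum_cong') auto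
    finally show ?thesis by (simp add: finsum_zero)
  qed
  obtain d i where d: "d \<in> I \<rightarrow> carrier R" "i \<in> I" "d i = \<one>"
    "\<And>m. m \<in> carrier R \<Longrightarrow> (\<Oplus>j\<in>I. d j \<otimes> (m \<otimes> e j)) = \<zero>"
    "\<And>j m. j \<in> I \<Longrightarrow> m \<in> carrier R \<Longrightarrow> d j \<otimes> m = m \<otimes> d j"
    using shortest_relation[OF fin(1) e carrier_is_subring, of "carrier R" "\<lambda>_ m. m" a]
      a(1,2) van inv_nonzero(1) by auto
  have "d \<in> I \<rightarrow> ring_center R" using d unfolding ring_center_def by auto
  moreover have "(\<Oplus>j\<in>I. d j \<otimes> e j) = (\<Oplus>j\<in>I. d j \<otimes> (\<one> \<otimes> e j))"
    using d(1) eC by (intro finsum_cong') auto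
  ultimately have "d i = \<zero>" using indep d(2,4) unfolding lin_indep_def by simp
  then show False using d(3) one_nonzero by simp
qed

end

section \<open>Opposite rings and centralizers\<close>

definition opposite_ring :: "('a, 'b) ring_scheme \<Rightarrow> ('a, 'b) ring_scheme" where
  "opposite_ring R = R\<lparr>mult := \<lambda>x y. y \<otimes>\<^bsub>R\<^esub> x\<rparr>"

lemma opposite_ring_simps [simp]:
  "carrier (opposite_ring R) = carrier R" "x \<otimes>\<^bsub>opposite_ring R\<^esub> y = y \<otimes>\<^bsub>R\<^esub> x"
  "\<one>\<^bsub>opposite_ring R\<^esub> = \<one>\<^bsub>R\<^esub>" "\<zero>\<^bsub>opposite_ring R\<^esub> = \<zero>\<^bsub>R\<^esub>"
  "x \<oplus>\<^bsub>opposite_ring R\<^esub> y = x \<oplus>\<^bsub>R\<^esub> y" "finsum (opposite_ring R) f J = finsum R f J"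
  by (simp_all add: opposite_ring_def finsum_def)

lemma (in ring) ring_opposite: "ring (opposite_ring R)"
proof (rule ringI)
  show "abelian_group (opposite_ring R)"
    by (rule abelian_groupI) (auto simp: a_ac intro: exI[of _ "\<ominus> _"] l_neg)
  show "monoid (opposite_ring R)"
    by (rule monoidI) (auto simp: m_assoc)
qed (auto simp: l_distr r_distr)

definition centralizer :: "('a, 'b) ring_scheme \<Rightarrow> 'a set \<Rightarrow> 'a set" where
  "centralizer R M = {x \<in> carrier R. \<forall>m \<in> M. x \<otimes>\<^bsub>R\<^esub> m = m \<otimes>\<^bsub>R\<^esub> x}"

lemma (in ring) subring_centralizer:
  assumes "M \<subseteq> carrier R"
  shows "subring (centralizer R M) R"
proof (rule subringI)
  fix h k assume h: "h \<in> centralizer R M" and k: "k \<in> centralizer R M"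
  show "\<ominus> h \<in> centralizer R M"
    using h assms by (auto simp: centralizer_def l_minus r_minus subset_eq)
  have "(h \<otimes> k) \<otimes> m = m \<otimes> (h \<otimes> k)" if "m \<in> M" for m
  proof -
    have c: "h \<in> carrier R" "k \<in> carrier R" "m \<in> carrier R" "h \<otimes> m = m \<otimes> h" "k \<otimes> m = m \<otimes> k"
      using h k that assms unfolding centralizer_def by auto
    then show ?thesis by (metis m_assoc)
  qed
  then show "h \<otimes> k \<in> centralizer R M"
    using h k by (auto simp: centralizer_def)
  show "h \<oplus> k \<in> centralizer R M"
    using h k assms by (auto simp: centralizer_def l_distr r_distr subset_eq)
qed (use assms in \<open>auto simp: centralizer_def subset_eq\<close>)

section \<open>Bounds on spanning and independent families, and inducing elements\<close>

context skew_field
begin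

lemma skew_field_opposite: "skew_field (opposite_ring R)"
proof -
  interpret o: ring "opposite_ring R" by (rule ring_opposite)
  have "Units (opposite_ring R) = Units R" by (auto simp: Units_def)
  then show ?thesis by unfold_locales (simp add: units)
qed

text \<open>The opposite ring exchanges left and right spans and respects independence over the
  centre, as central coefficients commute. The right-handed bound comes first because only there do
  the \<open>c j\<close> leave the sum without crossing the unknowns.\<close>

lemma card_le_of_left_spanning:
  assumes fin: "finite I" "finite J" and e: "e \<in> I \<rightarrow> carrier R" and y: "y \<in> J \<rightarrow> carrier R"
    and indep: "lin_indep (ring_center R) I e"
    and C: "C \<subseteq> carrier R" "\<And>i c. i \<in> I \<Longrightarrow> c \<in> C \<Longrightarrow> c \<otimes> e i = e i \<otimes> c"
    and spans: "carrier R \<subseteq> lin_span C J y"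
  shows "card I \<le> card J"
proof -
  interpret o: skew_field "opposite_ring R" by (rule skew_field_opposite)
  have Z: "ring_center (opposite_ring R) = ring_center R" by (auto simp: ring_center_def)
  have "o.lin_indep (ring_center R) I e"
    unfolding o.lin_indep_def opposite_ring_simps
  proof (intro ballI impI)
    fix c i assume c: "c \<in> I \<rightarrow> ring_center R" "(\<Oplus>i\<in>I. e i \<otimes> c i) = \<zero>" "i \<in> I"
    have "(\<Oplus>i\<in>I. c i \<otimes> e i) = (\<Oplus>i\<in>I. e i \<otimes> c i)"
      using c(1) e by (intro finsum_cong') (auto simp: ring_center_def Pi_def)
    then show "c i = \<zero>"
      using indep[unfolded lin_indep_def, rule_format, of c i] c by simp
  qed
  moreover have "\<exists>c \<in> J \<rightarrow> C. x = (\<Oplus>\<^bsub>opposite_ring R\<^esub>j\<in>J. y j \<otimes>\<^bsub>opposite_ring R\<^esub> c j)"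
    if "x \<in> carrier (opposite_ring R)" for x
    using that spans unfolding lin_span_def by auto
  ultimately show ?thesis
    using o.card_le_of_right_spanning[OF fin, of e y C] e y C Z by simp
qed

lemma centralizer_inv:
  assumes "M \<subseteq> carrier R" "c \<in> centralizer R M" "c \<noteq> \<zero>"
  shows "inv c \<in> centralizer R M"
proof -
  have c: "c \<in> carrier R" using assms unfolding centralizer_def by auto
  note i = inv_nonzero[OF c assms(3)]
  have "inv c \<otimes> m = m \<otimes> inv c" if "m \<in> M" for m
  proof -
    have m: "m \<in> carrier R" "c \<otimes> m = m \<otimes> c" using that assms unfolding centralizer_def by auto
    have "inv c \<otimes> m = inv c \<otimes> (m \<otimes> c) \<otimes> inv c" using m i c by (simp add: m_assoc)
    also have "\<dots> = (inv c \<otimes> c) \<otimes> m \<otimes> inv c" unfolding m(2)[symmetric] using m(1) i(1) c by (simp add: m_assoc)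
    finally show ?thesis using m i by simp
  qed
  then show ?thesis using i unfolding centralizer_def by auto
qed

text \<open>If \<open>y\<close> were dependent over the centralizer, fewer than \<open>card I\<close> of its members would span
  \<open>R\<close> over the centralizer, contradicting the previous bound.\<close>

lemma centralizer_subset_maximal:
  assumes fin: "finite I" "finite J" and M: "subring M R"
    and comm: "\<And>m n. m \<in> M \<Longrightarrow> n \<in> M \<Longrightarrow> m \<otimes> n = n \<otimes> m"
    and e: "e \<in> I \<rightarrow> M" "lin_indep (ring_center R) I e"
    and y: "y \<in> J \<rightarrow> carrier R" "carrier R \<subseteq> lin_span M J y"
    and card: "card J \<le> card I"
  shows "centralizer R M \<subseteq> M"
proof
  fix c assume c: "c \<in> centralizer R M"
  let ?C = "centralizer R M"
  note MS = subringE[OF M]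
  have C: "subring ?C R" using subring_centralizer[OF MS(1)] .
  note CS = subringE[OF C]
  have MC: "M \<subseteq> ?C" using comm MS(1) unfolding centralizer_def by auto
  have eC: "e \<in> I \<rightarrow> carrier R" using e MS(1) by auto
  have comm_e: "d \<otimes> e i = e i \<otimes> d" if "i \<in> I" "d \<in> ?C" for i d
    using that e(1) unfolding centralizer_def by auto
  have indep: "lin_indep ?C J y"
  proof (rule ccontr)
    assume "\<not> ?thesis"
    then obtain d j where d: "d \<in> J \<rightarrow> ?C" "(\<Oplus>j\<in>J. d j \<otimes> y j) = \<zero>" "j \<in> J" "d j \<noteq> \<zero>"
      unfolding lin_indep_def by blast
    define q where "q = inv (d j)"
    have dj: "d j \<in> ?C" "d j \<in> carrier R" using d CS(1) by auto
    have q: "q \<in> ?C" "q \<in> carrier R" "q \<otimes> d j = \<one>"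
      using centralizer_inv[OF MS(1) dj(1) d(4)] inv_nonzero[OF dj(2) d(4)] unfolding q_def by auto
    have dC: "d i \<in> carrier R" if "i \<in> J" for i using d(1) CS(1) that by auto
    have yC: "y i \<in> carrier R" if "i \<in> J" for i using y(1) that by auto
    let ?s = "\<Oplus>i\<in>J - {j}. d i \<otimes> y i"
    have s: "?s \<in> carrier R" using dC yC by (auto intro!: finsum_closed)
    have "d j \<otimes> y j \<oplus> ?s = \<zero>"
      using finsum_remove[OF fin(2) d(3), of "\<lambda>i. d i \<otimes> y i"] d(2) dC yC by auto
    then have 1: "d j \<otimes> y j = \<ominus> ?s" using s dj(2) yC[OF d(3)] by (simp add: minus_equality)
    have "y j = q \<otimes> (d j \<otimes> y j)" using q dj yC[OF d(3)] by (simp add: m_assoc[symmetric])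
    then have yj: "y j = \<ominus> (q \<otimes> ?s)" unfolding 1 using q(2) s by (simp add: r_minus)
    have "carrier R \<subseteq> lin_span ?C (J - {j}) y"
    proof
      fix x assume "x \<in> carrier R"
      then obtain m where m: "m \<in> J \<rightarrow> M" "x = (\<Oplus>i\<in>J. m i \<otimes> y i)"
        using y(2) unfolding lin_span_def by blast
      have mC: "m i \<in> carrier R" "m i \<in> ?C" if "i \<in> J" for i using m(1) MS(1) MC that by auto
      \<comment> \<open>Eliminating \<open>y j\<close> by \<open>yj\<close> turns
        \<open>m j \<otimes> y j\<close> into \<open>\<ominus> (p \<otimes> ?s)\<close>. The factor
        \<open>p\<close> lies in the centralizer because the commutative ring \<open>M\<close>
        does.\<close>
      define p where "p = m j \<otimes> q"
      have p: "p \<in> ?C" "p \<in> carrier R" using mC[OF d(3)] q CS(6) unfolding p_def by auto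
      have "x = m j \<otimes> y j \<oplus> (\<Oplus>i\<in>J - {j}. m i \<otimes> y i)"
        unfolding m(2) using finsum_remove[OF fin(2) d(3), of "\<lambda>i. m i \<otimes> y i"] mC yC by auto
      also have "m j \<otimes> y j = \<ominus> (p \<otimes> ?s)"
        unfolding yj p_def using mC[OF d(3)] q s by (simp add: r_minus m_assoc)
      also have "p \<otimes> ?s = (\<Oplus>i\<in>J - {j}. p \<otimes> (d i \<otimes> y i))"
        using p dC yC fin by (intro finsum_rdistr) auto
      also have "\<dots> = (\<Oplus>i\<in>J - {j}. (p \<otimes> d i) \<otimes> y i)"
        using p dC yC by (intro finsum_cong') (auto simp: m_assoc)
      also have "\<ominus> \<dots> \<oplus> (\<Oplus>i\<in>J - {j}. m i \<otimes> y i)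
          = (\<Oplus>i\<in>J - {j}. m i \<otimes> y i) \<ominus> (\<Oplus>i\<in>J - {j}. (p \<otimes> d i) \<otimes> y i)"
        unfolding minus_eq using p dC yC mC by (intro a_comm a_inv_closed finsum_closed) auto
      also have "\<dots> = (\<Oplus>i\<in>J - {j}. (m i \<ominus> p \<otimes> d i) \<otimes> y i)"
        using p dC yC mC fin by (intro lin_comb_subtract[symmetric]) auto
      finally have x: "x = (\<Oplus>i\<in>J - {j}. (m i \<ominus> p \<otimes> d i) \<otimes> y i)" .
      moreover have "(\<lambda>i. m i \<ominus> p \<otimes> d i) \<in> J - {j} \<rightarrow> ?C"
      proof
        fix i assume "i \<in> J - {j}"
        then have i: "m i \<in> ?C" "d i \<in> ?C" using mC(2)[of i] funcset_mem[OF d(1), of i] by blast+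
        show "m i \<ominus> p \<otimes> d i \<in> ?C"
          unfolding minus_eq by (rule CS(7)[OF i(1) CS(5)[OF CS(6)[OF p(1) i(2)]]])
      qed
      ultimately show "x \<in> lin_span ?C (J - {j}) y" using lin_spanI[of "\<lambda>i. m i \<ominus> p \<otimes> d i"] by simp
    qed
    then have "card I \<le> card (J - {j})"
      using card_le_of_left_spanning[OF fin(1) _ eC _ e(2) CS(1) comm_e, of "J - {j}" y] fin y by auto
    moreover have "card (J - {j}) < card J" using d(3) fin(2) by (rule card_Diff1_less[rotated])
    ultimately show False using card by simp
  qed
  have "J \<noteq> {}"
  proof
    assume "J = {}"
    then have "carrier R \<subseteq> {\<zero>}" using y(2) by (simp add: lin_span_empty)
    then show False using one_nonzero by auto
  qed
  then obtain j where j: "j \<in> J" by blast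
  have cC: "c \<in> carrier R" using c CS(1) by blast
  then have "c \<otimes> y j \<in> carrier R" using j y(1) by auto
  then obtain m where m: "m \<in> J \<rightarrow> M" "c \<otimes> y j = (\<Oplus>i\<in>J. m i \<otimes> y i)"
    using y(2) unfolding lin_span_def by blast
  \<comment> \<open>Two expansions of \<open>c \<otimes> y j\<close> over the centralizer are
    compared: the one-term expansion \<open>?d\<close>, and \<open>m\<close> with values in
    \<open>M\<close>. Uniqueness at the index \<open>j\<close> gives \<open>c = m j\<close>.\<close>
  let ?d = "\<lambda>i. if i = j then c else \<zero>"
  have "(\<Oplus>i\<in>J. ?d i \<otimes> y i) = ?d j \<otimes> y j"
    using fin j cC y(1) by (intro finsum_single) (auto simp: Pi_def)
  then have eq: "(\<Oplus>i\<in>J. ?d i \<otimes> y i) = (\<Oplus>i\<in>J. m i \<otimes> y i)" using m(2) by simp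
  have d: "?d \<in> J \<rightarrow> ?C" using c CS(2) by auto
  have m': "m \<in> J \<rightarrow> ?C" using m(1) MC by auto
  have "c = m j" using lin_indep_unique[OF indep C fin(2) y(1) d m' eq j] by simp
  then show "c \<in> M" using m j by auto
qed

text \<open>A linear system controls only the finitely many \<open>e i\<close>. Central coefficients
  pass through the \<open>\<tau> j\<close> and past the \<open>c j\<close>, so the relation extends
  to all their combinations.\<close>

lemma relation_on_lin_span:
  assumes fin: "finite I" "finite J" and y: "y \<in> J \<rightarrow> carrier R" and c: "c \<in> J \<rightarrow> carrier R"
    and Z: "Z \<subseteq> ring_center R"
    and \<tau>C: "\<And>j i. j \<in> J \<Longrightarrow> i \<in> I \<Longrightarrow> \<tau> j (e i) \<in> carrier R"
    and \<tau>lin: "\<And>j z. j \<in> J \<Longrightarrow> z \<in> I \<rightarrow> Z \<Longrightarrow> \<tau> j (\<Oplus>i\<in>I. z i \<otimes> e i) = (\<Oplus>i\<in>I. z i \<otimes> \<tau> j (e i))"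
    and rel: "\<And>i. i \<in> I \<Longrightarrow> (\<Oplus>j\<in>J. c j \<otimes> (\<tau> j (e i) \<otimes> y j)) = \<zero>"
    and m: "m \<in> lin_span Z I e"
  shows "(\<Oplus>j\<in>J. c j \<otimes> (\<tau> j m \<otimes> y j)) = \<zero>"
proof -
  obtain z where z: "z \<in> I \<rightarrow> Z" "m = (\<Oplus>i\<in>I. z i \<otimes> e i)"
    using m unfolding lin_span_def by blast
  have zC: "z i \<in> carrier R" "\<And>x. x \<in> carrier R \<Longrightarrow> z i \<otimes> x = x \<otimes> z i" if "i \<in> I" for i
    using z(1) Z that unfolding ring_center_def by auto
  have yC: "y j \<in> carrier R" "c j \<in> carrier R" if "j \<in> J" for j using y c that by auto
  have "(\<Oplus>j\<in>J. c j \<otimes> (\<tau> j m \<otimes> y j)) = (\<Oplus>j\<in>J. \<Oplus>i\<in>I. z i \<otimes> (c j \<otimes> (\<tau> j (e i) \<otimes> y j)))"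
  proof (intro finsum_cong')
    fix j assume j: "j \<in> J"
    have "c j \<otimes> (\<tau> j m \<otimes> y j) = (\<Oplus>i\<in>I. c j \<otimes> (z i \<otimes> \<tau> j (e i) \<otimes> y j))"
      unfolding z(2) \<tau>lin[OF j z(1)] using fin yC[OF j] zC(1) \<tau>C[OF j]
      by (subst finsum_ldistr; (subst finsum_rdistr)?) auto
    also have "\<dots> = (\<Oplus>i\<in>I. z i \<otimes> (c j \<otimes> (\<tau> j (e i) \<otimes> y j)))"
    proof (intro finsum_cong')
      fix i assume i: "i \<in> I"
      have "c j \<otimes> (z i \<otimes> \<tau> j (e i) \<otimes> y j) = (c j \<otimes> z i) \<otimes> (\<tau> j (e i) \<otimes> y j)"
        using yC[OF j] zC(1)[OF i] \<tau>C[OF j i] by (simp add: m_assoc)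
      also have "\<dots> = z i \<otimes> (c j \<otimes> (\<tau> j (e i) \<otimes> y j))"
        unfolding zC(2)[OF i yC(2)[OF j], symmetric]
        using yC[OF j] zC(1)[OF i] \<tau>C[OF j i] by (simp add: m_assoc)
      finally show "c j \<otimes> (z i \<otimes> \<tau> j (e i) \<otimes> y j) = z i \<otimes> (c j \<otimes> (\<tau> j (e i) \<otimes> y j))" .
    qed (use yC[OF j] zC(1) \<tau>C[OF j] in auto)
    finally show "c j \<otimes> (\<tau> j m \<otimes> y j) = (\<Oplus>i\<in>I. z i \<otimes> (c j \<otimes> (\<tau> j (e i) \<otimes> y j)))" .
  qed (use yC zC(1) \<tau>C in \<open>auto intro!: finsum_closed\<close>)
  also have "\<dots> = (\<Oplus>i\<in>I. \<Oplus>j\<in>J. z i \<otimes> (c j \<otimes> (\<tau> j (e i) \<otimes> y j)))"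
    using fin yC zC(1) \<tau>C by (intro finsum_swap) auto
  also have "\<dots> = (\<Oplus>i\<in>I. z i \<otimes> (\<Oplus>j\<in>J. c j \<otimes> (\<tau> j (e i) \<otimes> y j)))"
    using fin yC zC(1) \<tau>C by (intro finsum_cong' finsum_rdistr[symmetric]) auto
  also have "\<dots> = (\<Oplus>i\<in>I. \<zero>)"
    using rel zC(1) by (intro finsum_cong') auto
  finally show ?thesis by (simp add: finsum_zero)
qed

text \<open>With more \<open>y j\<close> than \<open>e i\<close>, some nontrivial \<open>c\<close>
  makes the sum of \<open>c j \<otimes> (m \<otimes> y j)\<close> vanish for all \<open>m\<close> in
  \<open>M\<close>. The coefficients of a shortest such relation commute with \<open>M\<close>,
  hence lie in \<open>M\<close>, and \<open>m = \<one>\<close> contradicts independence.\<close>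

lemma card_lin_indep_le:
  assumes fin: "finite I" "finite J" and M: "subring M R"
    and e: "e \<in> I \<rightarrow> carrier R" "M \<subseteq> lin_span (ring_center R) I e"
    and cent: "centralizer R M \<subseteq> M"
    and y: "y \<in> J \<rightarrow> carrier R" "lin_indep M J y"
  shows "card J \<le> card I"
proof (rule ccontr)
  assume "\<not> ?thesis"
  then have "card I < card J" by simp
  then obtain c where c: "c \<in> J \<rightarrow> carrier R" "\<exists>j\<in>J. c j \<noteq> \<zero>"
      "\<forall>i\<in>I. (\<Oplus>j\<in>J. c j \<otimes> (e i \<otimes> y j)) = \<zero>"
    using homogeneous_system[OF fin, of "\<lambda>j i. e i \<otimes> y j"] e y by (auto simp: Pi_def)
  note MS = subringE[OF M]
  have van: "(\<Oplus>j\<in>J. c j \<otimes> (m \<otimes> y j)) = \<zero>" if "m \<in> M" for m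
    using relation_on_lin_span[OF fin y(1) c(1) order_refl, of "\<lambda>_ m. m" e m] c(3) e that by auto
  obtain d i where d: "d \<in> J \<rightarrow> carrier R" "i \<in> J" "d i = \<one>"
    "\<And>m. m \<in> M \<Longrightarrow> (\<Oplus>j\<in>J. d j \<otimes> (m \<otimes> y j)) = \<zero>"
    "\<And>j m. j \<in> J \<Longrightarrow> m \<in> M \<Longrightarrow> d j \<otimes> m = m \<otimes> d j"
    using shortest_relation[OF fin(2) y(1) carrier_is_subring, of M "\<lambda>_ m. m" c]
      c(1,2) van inv_nonzero(1) MS(1,6) by (auto simp: subset_eq)
  have dM: "d \<in> J \<rightarrow> M" using d(1,5) cent unfolding centralizer_def by auto
  have "(\<Oplus>j\<in>J. d j \<otimes> y j) = (\<Oplus>j\<in>J. d j \<otimes> (\<one> \<otimes> y j))"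
    using d(1) y(1) by (intro finsum_cong') (auto simp: Pi_def)
  also have "\<dots> = \<zero>" using d(4) MS(3) by blast
  finally have "d i = \<zero>" using y(2) dM d(2) unfolding lin_indep_def by blast
  then show False using d(3) one_nonzero by simp
qed


text \<open>The terms \<open>m \<otimes> y j\<close> alone already provide as many unknowns as there
  are equations; one more term, in which \<open>\<sigma> m\<close> replaces \<open>m\<close>, forces
  a relation. Intertwining between the new term and an old one yields \<open>x\<close> or its
  inverse. Independence and the hypothesis on the centralizer exclude a relation among the old terms
  only.\<close>

theorem skolem_noether_maximal:
  fixes y :: "'j \<Rightarrow> 'a"
  assumes fin: "finite I" "finite J" and M: "subring M R"
    and e: "e \<in> I \<rightarrow> M" "M \<subseteq> lin_span (ring_center R) I e"
    and cent: "centralizer R M \<subseteq> M"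
    and y: "y \<in> J \<rightarrow> carrier R" "lin_indep M J y" and card: "card I \<le> card J"
    and \<sigma>: "\<sigma> \<in> M \<rightarrow> M" "\<And>m n. m \<in> M \<Longrightarrow> n \<in> M \<Longrightarrow> \<sigma> (m \<otimes> n) = \<sigma> m \<otimes> \<sigma> n" "\<sigma> \<one> = \<one>"
      "\<And>z. z \<in> I \<rightarrow> ring_center R \<Longrightarrow> \<sigma> (\<Oplus>i\<in>I. z i \<otimes> e i) = (\<Oplus>i\<in>I. z i \<otimes> \<sigma> (e i))"
  obtains x where "x \<in> carrier R" "x \<noteq> \<zero>" "\<And>m. m \<in> M \<Longrightarrow> x \<otimes> m = \<sigma> m \<otimes> x"
proof -
  note MS = subringE[OF M]
  \<comment> \<open>The index \<open>None\<close> stands for the additional term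
    \<open>\<sigma> m \<otimes> \<one>\<close>.\<close>
  define J' where "J' = insert None (Some ` J)"
  define y' where "y' = (\<lambda>k. case k of None \<Rightarrow> \<one> | Some j \<Rightarrow> y j)"
  define \<tau> where "\<tau> = (\<lambda>(k :: 'j option) m. case k of None \<Rightarrow> \<sigma> m | Some j \<Rightarrow> m)"
  have J': "finite J'" "card I < card J'"
    using fin card by (auto simp: J'_def card_image)
  have y': "y' \<in> J' \<rightarrow> carrier R" using y(1) by (auto simp: J'_def y'_def)
  have \<tau>: "\<tau> k m \<in> carrier R" if "k \<in> J'" "m \<in> M" for k m
    using that \<sigma>(1) MS(1) by (auto simp: J'_def \<tau>_def)
  have eM: "e i \<in> M" "e i \<in> carrier R" if "i \<in> I" for i using e(1) MS(1) that by auto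
  have "\<tau> k (e i) \<otimes> y' k \<in> carrier R" if "k \<in> J'" "i \<in> I" for k i
    using \<tau> that eM y' by auto
  then obtain c where c: "c \<in> J' \<rightarrow> carrier R" "\<exists>j\<in>J'. c j \<noteq> \<zero>"
      "\<forall>i\<in>I. (\<Oplus>k\<in>J'. c k \<otimes> (\<tau> k (e i) \<otimes> y' k)) = \<zero>"
    using homogeneous_system[OF fin(1) J', of "\<lambda>k i. \<tau> k (e i) \<otimes> y' k"] by auto
  have van: "(\<Oplus>k\<in>J'. c k \<otimes> (\<tau> k m \<otimes> y' k)) = \<zero>" if m: "m \<in> M" for m
  proof (rule relation_on_lin_span[OF fin(1) J'(1) y' c(1) order_refl])
    fix k z assume "k \<in> J'" "z \<in> I \<rightarrow> ring_center R"
    then show "\<tau> k (\<Oplus>i\<in>I. z i \<otimes> e i) = (\<Oplus>i\<in>I. z i \<otimes> \<tau> k (e i))"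
      using \<sigma>(4) by (auto simp: J'_def \<tau>_def)
  qed (use c e m \<tau> eM in auto)
  have \<tau>mult: "\<tau> k (m \<otimes> n) = \<tau> k m \<otimes> \<tau> k n" if "k \<in> J'" "m \<in> M" "n \<in> M" for k m n
    using that \<sigma>(2) by (auto simp: J'_def \<tau>_def)
  obtain d i where d: "d \<in> J' \<rightarrow> carrier R" "i \<in> J'" "d i = \<one>"
    "\<And>m. m \<in> M \<Longrightarrow> (\<Oplus>k\<in>J'. d k \<otimes> (\<tau> k m \<otimes> y' k)) = \<zero>"
    "\<And>k m. k \<in> J' \<Longrightarrow> m \<in> M \<Longrightarrow> d k \<otimes> \<tau> k m = \<tau> i m \<otimes> d k"
  proof (rule shortest_relation[OF J'(1) y' carrier_is_subring, of M \<tau> c])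
    show "inv a \<in> carrier R" if "a \<in> carrier R" "a \<noteq> \<zero>" for a by (rule inv_nonzero(1)[OF that])
    show "\<tau> k m \<in> carrier R" if "k \<in> J'" "m \<in> M" for k m by (rule \<tau>[OF that])
    show "\<tau> k (m \<otimes> n) = \<tau> k m \<otimes> \<tau> k n" if "k \<in> J'" "m \<in> M" "n \<in> M" for k m n
      by (rule \<tau>mult[OF that])
    show "m \<otimes> n \<in> M" if "m \<in> M" "n \<in> M" for m n by (rule MS(6)[OF that])
    show "(\<Oplus>k\<in>J'. c k \<otimes> (\<tau> k m \<otimes> y' k)) = \<zero>" if "m \<in> M" for m by (rule van[OF that])
    show "c \<in> J' \<rightarrow> carrier R" "\<exists>k\<in>J'. c k \<noteq> \<zero>" by (rule c)+
  qed (rule that, assumption+)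
  have dC: "d k \<in> carrier R" if "k \<in> J'" for k using d(1) that by auto
  have dn: "d None \<in> carrier R" using dC unfolding J'_def by auto
  have tC: "d k \<otimes> (\<tau> k \<one> \<otimes> y' k) \<in> carrier R" if "k \<in> J'" for k
    by (intro m_closed dC[OF that] \<tau>[OF that MS(3)] funcset_mem[OF y' that])
  have dsum: "d None \<oplus> (\<Oplus>j\<in>J. d (Some j) \<otimes> y j) = \<zero>"
  proof -
    have "(\<Oplus>k\<in>J'. d k \<otimes> (\<tau> k \<one> \<otimes> y' k)) = d None \<otimes> (\<tau> None \<one> \<otimes> y' None)
        \<oplus> (\<Oplus>k\<in>Some ` J. d k \<otimes> (\<tau> k \<one> \<otimes> y' k))"
      unfolding J'_def using fin tC by (intro finsum_insert) (auto simp: J'_def)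
    also have "(\<Oplus>k\<in>Some ` J. d k \<otimes> (\<tau> k \<one> \<otimes> y' k))
        = (\<Oplus>j\<in>J. d (Some j) \<otimes> (\<tau> (Some j) \<one> \<otimes> y' (Some j)))"
      using tC by (intro finsum_reindex) (auto simp: J'_def)
    also have "\<dots> = (\<Oplus>j\<in>J. d (Some j) \<otimes> y j)"
      using dC y(1) by (intro finsum_cong') (auto simp: J'_def \<tau>_def y'_def Pi_def)
    finally show ?thesis using d(4)[OF MS(3)] \<sigma>(3) dn by (simp add: \<tau>_def y'_def)
  qed
  show ?thesis
  proof (cases i)
    case None
    \<comment> \<open>The new term is the normalised one, so at \<open>m = \<one>\<close> it
      contributes \<open>\<one>\<close>, which some old term has to cancel. Its coefficient
      intertwines in the required direction.\<close>
    have "\<exists>j\<in>J. d (Some j) \<noteq> \<zero>"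
    proof (rule ccontr)
      assume "\<not> ?thesis"
      then have "(\<Oplus>j\<in>J. d (Some j) \<otimes> y j) = (\<Oplus>j\<in>J. \<zero>)"
        using y(1) by (intro finsum_cong') (auto simp: Pi_def)
      then show False using dsum None d(3) one_nonzero by (simp add: finsum_zero)
    qed
    then obtain j where j: "j \<in> J" "d (Some j) \<noteq> \<zero>" by blast
    show ?thesis
    proof (rule that[of "d (Some j)"])
      show "d (Some j) \<in> carrier R" using dC j unfolding J'_def by auto
      show "d (Some j) \<otimes> m = \<sigma> m \<otimes> d (Some j)" if "m \<in> M" for m
        using d(5)[OF _ that, of "Some j"] j None unfolding J'_def \<tau>_def by auto
    qed (rule j(2))
  next
    case (Some j)
    \<comment> \<open>An old term is normalised here and the intertwining runs backwards, so the
      witness is the inverse of \<open>d None\<close>, once this is known to be nonzero.\<close>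
    have \<sigma>d: "d None \<otimes> \<sigma> m = m \<otimes> d None" if "m \<in> M" for m
      using d(5)[OF _ that, of None] Some unfolding J'_def \<tau>_def by auto
    have "d None \<noteq> \<zero>"
    proof
      assume 0: "d None = \<zero>"
      have sm: "(\<Oplus>j\<in>J. d (Some j) \<otimes> y j) \<in> carrier R"
        using dC y(1) by (intro finsum_closed) (auto simp: J'_def Pi_def)
      have "d (Some j) \<in> M" if "j \<in> J" for j
      proof -
        have "d (Some j) \<otimes> m = m \<otimes> d (Some j)" if "m \<in> M" for m
          using d(5)[OF _ that, of "Some j"] \<open>j \<in> J\<close> Some unfolding J'_def \<tau>_def by auto
        then show ?thesis using cent dC that unfolding centralizer_def J'_def by auto
      qed
      then have dM: "(\<lambda>j. d (Some j)) \<in> J \<rightarrow> M" by blast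
      have s0: "(\<Oplus>j\<in>J. d (Some j) \<otimes> y j) = \<zero>" using dsum 0 sm by simp
      have "d (Some k) = \<zero>" if "k \<in> J" for k
        by (rule lin_indepD[OF y(2) dM s0 that])
      then show False using d(2,3) Some one_nonzero unfolding J'_def by auto
    qed
    note i = inv_nonzero[OF dn this]
    show ?thesis
    proof (rule that[of "inv (d None)"])
      show "inv (d None) \<noteq> \<zero>" using i one_nonzero dn by auto
      show "inv (d None) \<otimes> m = \<sigma> m \<otimes> inv (d None)" if m: "m \<in> M" for m
      proof -
        have mC: "m \<in> carrier R" "\<sigma> m \<in> carrier R" using m \<sigma>(1) MS(1) by auto
        have "inv (d None) \<otimes> m = inv (d None) \<otimes> (m \<otimes> d None) \<otimes> inv (d None)"
          using i mC dn by (simp add: m_assoc)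
        also have "\<dots> = (inv (d None) \<otimes> d None) \<otimes> \<sigma> m \<otimes> inv (d None)"
          unfolding \<sigma>d[OF m, symmetric] using i(1) mC dn by (simp add: m_assoc)
        finally show ?thesis using i mC by simp
      qed
    qed (rule i(1))
  qed
qed

text \<open>Multiplying a relation by \<open>m\<close> on the right inserts
  \<open>\<sigma> m\<close> between the coefficient and \<open>x \<sigma>\<close>, the shape treated
  by \<open>shortest_relation\<close>. In the commutative ring \<open>M\<close> the intertwining
  becomes \<open>d \<sigma> \<otimes> (\<sigma> m \<ominus> \<rho> m) = \<zero>\<close>, so only the
  term at \<open>\<rho>\<close> survives.\<close>

lemma lin_indep_inducing:
  assumes "finite S" and M: "subring M R" "\<And>a. a \<in> M \<Longrightarrow> a \<noteq> \<zero> \<Longrightarrow> inv a \<in> M"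
    and comm: "\<And>m n. m \<in> M \<Longrightarrow> n \<in> M \<Longrightarrow> m \<otimes> n = n \<otimes> m"
    and S: "S \<subseteq> M \<rightarrow>\<^sub>E M" "\<And>\<sigma> m n. \<sigma> \<in> S \<Longrightarrow> m \<in> M \<Longrightarrow> n \<in> M \<Longrightarrow> \<sigma> (m \<otimes> n) = \<sigma> m \<otimes> \<sigma> n"
    and x: "x \<in> S \<rightarrow> carrier R - {\<zero>}" "\<And>\<sigma> m. \<sigma> \<in> S \<Longrightarrow> m \<in> M \<Longrightarrow> x \<sigma> \<otimes> m = \<sigma> m \<otimes> x \<sigma>"
  shows "lin_indep M S x"
proof (rule ccontr)
  assume "\<not> ?thesis"
  then obtain c where c: "c \<in> S \<rightarrow> M" "(\<Oplus>\<sigma>\<in>S. c \<sigma> \<otimes> x \<sigma>) = \<zero>" "\<exists>\<sigma>\<in>S. c \<sigma> \<noteq> \<zero>"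
    unfolding lin_indep_def by blast
  note MS = subringE[OF M(1)]
  have xC: "x \<in> S \<rightarrow> carrier R" using x(1) by auto
  have \<sigma>M: "\<sigma> m \<in> M" if "\<sigma> \<in> S" "m \<in> M" for \<sigma> m using S(1) that by blast
  have cC: "c \<sigma> \<in> carrier R" if "\<sigma> \<in> S" for \<sigma> using c(1) MS(1) that by auto
  have van: "(\<Oplus>\<sigma>\<in>S. c \<sigma> \<otimes> (\<sigma> m \<otimes> x \<sigma>)) = \<zero>" if m: "m \<in> M" for m
  proof -
    have mC: "m \<in> carrier R" using m MS(1) by auto
    have "(\<Oplus>\<sigma>\<in>S. c \<sigma> \<otimes> (\<sigma> m \<otimes> x \<sigma>)) = (\<Oplus>\<sigma>\<in>S. c \<sigma> \<otimes> x \<sigma> \<otimes> m)"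
      using cC xC mC x(2)[OF _ m, symmetric] by (intro finsum_cong') (auto simp: m_assoc Pi_def)
    also have "\<dots> = (\<Oplus>\<sigma>\<in>S. c \<sigma> \<otimes> x \<sigma>) \<otimes> m"
      using cC xC mC assms(1) by (intro finsum_ldistr[symmetric]) auto
    finally show ?thesis using c(2) mC by simp
  qed
  obtain d \<rho> where d: "d \<in> S \<rightarrow> M" "\<rho> \<in> S" "d \<rho> = \<one>"
    "\<And>m. m \<in> M \<Longrightarrow> (\<Oplus>\<sigma>\<in>S. d \<sigma> \<otimes> (\<sigma> m \<otimes> x \<sigma>)) = \<zero>"
    "\<And>\<sigma> m. \<sigma> \<in> S \<Longrightarrow> m \<in> M \<Longrightarrow> d \<sigma> \<otimes> \<sigma> m = \<rho> m \<otimes> d \<sigma>"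
  proof (rule shortest_relation[OF assms(1) xC M(1), of M "\<lambda>\<sigma>. \<sigma>" c])
    show "(\<Oplus>\<sigma>\<in>S. c \<sigma> \<otimes> (\<sigma> m \<otimes> x \<sigma>)) = \<zero>" if "m \<in> M" for m
      by (rule van[OF that])
    show "inv a \<in> M" if "a \<in> M" "a \<noteq> \<zero>" for a by (rule M(2)[OF that])
    show "\<sigma> m \<in> M" if "\<sigma> \<in> S" "m \<in> M" for \<sigma> m by (rule \<sigma>M[OF that])
    show "\<sigma> (m \<otimes> n) = \<sigma> m \<otimes> \<sigma> n" if "\<sigma> \<in> S" "m \<in> M" "n \<in> M" for \<sigma> m n by (rule S(2)[OF that])
    show "m \<otimes> n \<in> M" if "m \<in> M" "n \<in> M" for m n by (rule MS(6)[OF that])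
    show "c \<in> S \<rightarrow> M" "\<exists>\<sigma>\<in>S. c \<sigma> \<noteq> \<zero>" by (rule c)+
  qed (rule that, assumption+)
  have dC: "d \<sigma> \<in> carrier R" if "\<sigma> \<in> S" for \<sigma> using d(1) MS(1) that by auto
  have d0: "d \<sigma> = \<zero>" if \<sigma>: "\<sigma> \<in> S" "\<sigma> \<noteq> \<rho>" for \<sigma>
  proof -
    \<comment> \<open>Distinct members of \<open>S\<close> differ at a point of \<open>M\<close>
      because they are extensional on \<open>M\<close>.\<close>
    obtain m where m: "m \<in> M" "\<sigma> m \<noteq> \<rho> m"
      using \<sigma> S(1) d(2) by (meson PiE_ext subsetD)
    have C: "\<sigma> m \<in> carrier R" "\<rho> m \<in> carrier R" using \<sigma>M m \<sigma> d(2) MS(1) by auto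
    have "d \<sigma> \<otimes> \<sigma> m = d \<sigma> \<otimes> \<rho> m"
      using d(5)[OF \<sigma>(1) m(1)] comm[of "\<rho> m" "d \<sigma>"] \<sigma>M m d(1,2) \<sigma> by auto
    then have "d \<sigma> \<otimes> (\<sigma> m \<ominus> \<rho> m) = \<zero>"
      using C dC[OF \<sigma>(1)] by (simp add: minus_eq r_distr r_minus r_neg)
    then have "d \<sigma> = \<zero> \<or> \<sigma> m \<ominus> \<rho> m = \<zero>"
      by (rule integral_skew) (use dC[OF \<sigma>(1)] C in auto)
    then show ?thesis using C m(2) by auto
  qed
  have 1: "\<one> \<in> M" by (rule MS(3))
  have "(\<Oplus>\<sigma>\<in>S. d \<sigma> \<otimes> (\<sigma> \<one> \<otimes> x \<sigma>)) = d \<rho> \<otimes> (\<rho> \<one> \<otimes> x \<rho>)"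
    using d0 d(2) assms(1) dC xC \<sigma>M[OF _ 1] MS(1) by (intro finsum_single) (auto simp: Pi_def subset_eq)
  moreover have "\<rho> \<one> \<otimes> x \<rho> \<in> carrier R" using funcset_mem[OF xC d(2)] \<sigma>M[OF d(2) 1] MS(1) by blast
  ultimately have "\<rho> \<one> \<otimes> x \<rho> = \<zero>" using d(4)[OF 1] d(3) by simp
  then have "x \<rho> \<otimes> \<one> = \<zero>" using x(2)[OF d(2) 1] by simp
  then show False using funcset_mem[OF x(1) d(2)] by simp
qed

end

subsection \<open>Transfer to subrings and cyclic groups of prime order\<close>

context ring
begin

lemma dimension_subset_eq:
  assumes "subfield K R" "dimension n K E" "dimension n K E'" "E' \<subseteq> E"
  shows "E' = E"
proof -
  obtain Us where Us: "set Us \<subseteq> carrier R" "independent K Us" "length Us = n" "Span K Us = E'"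
    using exists_base[OF assms(1,3)] by blast
  then have "set Us \<subseteq> E" using Span_base_incl[OF assms(1)] assms(4) by blast
  then show ?thesis
    using independent_length_eq_dimension[OF assms(1,2) Us(2)] Us(3,4) by blast
qed

text \<open>The bounds will be applied in the structure carried by M(G), while its elements are
  written as sums formed in \<open>A\<close>; this lemma and the next two translate between the
  two.\<close>

lemma lin_comb_consistent:
  assumes "subring S R" "K \<subseteq> S" "y \<in> J \<rightarrow> S" "c \<in> J \<rightarrow> K"
  shows "(\<Oplus>\<^bsub>R\<lparr>carrier := S\<rparr>\<^esub>j\<in>J. c j \<otimes> y j) = (\<Oplus>j\<in>J. c j \<otimes> y j)"
proof (rule finsum_consistent[OF assms(1)])
  show "(\<lambda>j. c j \<otimes> y j) \<in> J \<rightarrow> S"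
  proof
    fix j assume "j \<in> J"
    then have "c j \<in> S" "y j \<in> S" using assms(2-4) by auto
    then show "c j \<otimes> y j \<in> S" by (rule subringE(6)[OF assms(1)])
  qed
qed

lemma lin_indep_consistent:
  assumes "subring S R" "K \<subseteq> S" "y \<in> J \<rightarrow> S"
  shows "ring.lin_indep (R\<lparr>carrier := S\<rparr>) K J y \<longleftrightarrow> lin_indep K J y"
  unfolding ring.lin_indep_def[OF subring_is_ring[OF assms(1)]] lin_indep_def
  using lin_comb_consistent[OF assms] by simp

lemma lin_span_consistent:
  assumes "subring S R" "K \<subseteq> S" "y \<in> J \<rightarrow> S"
  shows "ring.lin_span (R\<lparr>carrier := S\<rparr>) K J y = lin_span K J y"
  unfolding ring.lin_span_def[OF subring_is_ring[OF assms(1)]] lin_span_def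
proof (intro Collect_cong iffI; elim exE conjE)
  fix x c assume "x = (\<Oplus>\<^bsub>R\<lparr>carrier := S\<rparr>\<^esub>j\<in>J. c j \<otimes>\<^bsub>R\<lparr>carrier := S\<rparr>\<^esub> y j)" "c \<in> J \<rightarrow> K"
  then show "\<exists>c. x = (\<Oplus>j\<in>J. c j \<otimes> y j) \<and> c \<in> J \<rightarrow> K"
    using lin_comb_consistent[OF assms] by auto
next
  fix x c assume "x = (\<Oplus>j\<in>J. c j \<otimes> y j)" "c \<in> J \<rightarrow> K"
  then show "\<exists>c. x = (\<Oplus>\<^bsub>R\<lparr>carrier := S\<rparr>\<^esub>j\<in>J. c j \<otimes>\<^bsub>R\<lparr>carrier := S\<rparr>\<^esub> y j) \<and> c \<in> J \<rightarrow> K"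
    using lin_comb_consistent[OF assms] by (intro exI[of _ c]) simp
qed

end

context skew_field
begin

lemma skew_field_subring:
  assumes "subring S R" "\<And>a. a \<in> S \<Longrightarrow> a \<noteq> \<zero> \<Longrightarrow> inv a \<in> S"
  shows "skew_field (R\<lparr>carrier := S\<rparr>)"
proof -
  interpret S: ring "R\<lparr>carrier := S\<rparr>" by (rule subring_is_ring[OF assms(1)])
  note SC = subringE[OF assms(1)]
  have "Units (R\<lparr>carrier := S\<rparr>) = S - {\<zero>}"
  proof (intro equalityI subsetI)
    fix a assume "a \<in> Units (R\<lparr>carrier := S\<rparr>)"
    then show "a \<in> S - {\<zero>}"
      using SC(1) one_nonzero by (auto simp: Units_def subset_eq)
  next
    fix a assume a: "a \<in> S - {\<zero>}"
    then have "a \<in> carrier R" "a \<noteq> \<zero>" using SC(1) by auto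
    from inv_nonzero[OF this] show "a \<in> Units (R\<lparr>carrier := S\<rparr>)"
      using a assms(2) by (auto simp: Units_def)
  qed
  then show ?thesis by unfold_locales simp
qed

text \<open>Needed because \<open>cp_embed\<close> inverts in \<open>L\<close>, whereas all
  computations invert in \<open>A\<close>.\<close>

lemma inv_subring:
  assumes "subring S R" "a \<in> S" "a \<noteq> \<zero>" "inv a \<in> S"
  shows "inv\<^bsub>R\<lparr>carrier := S\<rparr>\<^esub> a = inv a"
proof -
  interpret S: ring "R\<lparr>carrier := S\<rparr>" by (rule subring_is_ring[OF assms(1)])
  have "a \<in> carrier R" using subringE(1)[OF assms(1)] assms(2) by blast
  from inv_nonzero[OF this assms(3)] show ?thesis
    using S.inv_char[of a "inv a"] assms by simp
qed

lemma subfield_of_inv_closed: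
  assumes "subring K R" "\<And>a. a \<in> K \<Longrightarrow> a \<noteq> \<zero> \<Longrightarrow> inv a \<in> K"
    and "\<And>a b. a \<in> K \<Longrightarrow> b \<in> K \<Longrightarrow> a \<otimes> b = b \<otimes> a"
  shows "subfield K R"
proof (rule subfieldI)
  show "subcring K R" by (rule subcringI[OF assms(1,3)])
  show "Units (R\<lparr>carrier := K\<rparr>) = K - {\<zero>}"
    using skew_field.units[OF skew_field_subring[OF assms(1,2)]] by simp
qed

end

lemma (in group) cyclic_group_prime_card:
  assumes "Factorial_Ring.prime (card (carrier G))"
  shows "cyclic_group G"
proof -
  have "1 < card (carrier G)" using assms prime_gt_1_nat by blast
  then obtain x where x: "x \<in> carrier G" "x \<noteq> \<one>"
    using card_le_Suc0_iff_eq[of "carrier G"] card_ge_0_finite[of "carrier G"] one_closed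
    by (metis One_nat_def less_trans not_less zero_less_one)
  let ?H = "range (\<lambda>n::int. x [^] n)"
  have H: "subgroup ?H G"
    using subgroup_subgroup_generated[of "{x}"] carrier_subgroup_generated_by_singleton[OF x(1)] by simp
  have fin: "finite (carrier G)" using \<open>1 < card (carrier G)\<close> by (intro card_ge_0_finite) simp
  have HC: "?H \<subseteq> carrier G" using subgroup.subset[OF H] .
  have "card ?H dvd card (carrier G)"
    using lagrange[OF H] unfolding order_def by (metis dvd_triv_right)
  moreover have "card ?H \<noteq> 1"
  proof
    assume "card ?H = 1"
    then obtain a where "?H = {a}" by (metis card_1_singletonE)
    moreover have "x [^] (0::int) \<in> ?H" "x [^] (1::int) \<in> ?H" by blast+
    ultimately show False using x by auto
  qed
  ultimately have "card ?H = card (carrier G)"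
    using assms prime_nat_iff by blast
  then have "?H = carrier G" using HC fin by (simp add: card_subset_eq)
  then show ?thesis unfolding cyclic_group using x(1) by auto
qed

subsection \<open>Automorphisms of a maximal subfield\<close>

sublocale central_division_algebra \<subseteq> skew_field A
  by unfold_locales (rule division)

locale maximal_subfield_algebra = central_division_algebra F A for F and A (structure) +
  fixes M
  assumes maximal: "maximal_subfield F A M"
begin

abbreviation "L \<equiv> A\<lparr>carrier := M\<rparr>"
abbreviation "G \<equiv> aut_group F L"
abbreviation "Z \<equiv> fixed_field L G"

lemma subfield_M: "subfield M A" and F_subset_M: "F \<subseteq> M"
  using maximal unfolding maximal_subfield_def by auto

lemmas subring_M = subfieldE(1)[OF subfield_M]
lemmas M_closed = subringE[OF subring_M]
lemmas M_comm = subfieldE(4)[OF subfield_M]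

lemma M_inv: "a \<in> M \<Longrightarrow> a \<noteq> \<zero> \<Longrightarrow> inv a \<in> M"
  using subfield_m_inv(1)[OF subfield_M] by blast

lemma autE:
  assumes "\<sigma> \<in> carrier G"
  shows "\<sigma> \<in> M \<rightarrow>\<^sub>E M" "\<And>m. m \<in> M \<Longrightarrow> \<sigma> m \<in> M" "bij_betw \<sigma> M M"
    "\<And>m n. m \<in> M \<Longrightarrow> n \<in> M \<Longrightarrow> \<sigma> (m \<otimes> n) = \<sigma> m \<otimes> \<sigma> n"
    "\<And>m n. m \<in> M \<Longrightarrow> n \<in> M \<Longrightarrow> \<sigma> (m \<oplus> n) = \<sigma> m \<oplus> \<sigma> n"
    "\<sigma> \<one> = \<one>" "\<And>z. z \<in> F \<Longrightarrow> \<sigma> z = z" "\<sigma> \<in> Bij M"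
proof -
  have s: "\<sigma> \<in> ring_hom L L" "bij_betw \<sigma> M M" "\<sigma> \<in> extensional M" "\<forall>z\<in>F. \<sigma> z = z"
    using assms unfolding aut_group_def ring_iso_def by auto
  show "\<sigma> \<in> M \<rightarrow>\<^sub>E M" using ring_hom_closed[OF s(1)] s(3) by (auto simp: PiE_def)
  show "\<sigma> m \<in> M" if "m \<in> M" for m using ring_hom_closed[OF s(1)] that by auto
  show "bij_betw \<sigma> M M" by (rule s(2))
  show "\<sigma> (m \<otimes> n) = \<sigma> m \<otimes> \<sigma> n" if "m \<in> M" "n \<in> M" for m n
    using ring_hom_mult[OF s(1), of m n] that by simp
  show "\<sigma> (m \<oplus> n) = \<sigma> m \<oplus> \<sigma> n" if "m \<in> M" "n \<in> M" for m n
    using ring_hom_add[OF s(1), of m n] that by simp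
  show "\<sigma> \<one> = \<one>" using ring_hom_one[OF s(1)] by simp
  show "\<sigma> z = z" if "z \<in> F" for z using s(4) that by blast
  show "\<sigma> \<in> Bij M" unfolding Bij_def using s by auto
qed

lemma group_G: "group G"
proof -
  interpret L: ring L by (rule subring_is_ring[OF subring_M])
  show ?thesis using L.group_aut_group[of F] F_subset_M by simp
qed

sublocale G: group G by (rule group_G)

lemma G_mult: "\<sigma> \<in> carrier G \<Longrightarrow> \<tau> \<in> carrier G \<Longrightarrow> m \<in> M \<Longrightarrow> (\<sigma> \<otimes>\<^bsub>G\<^esub> \<tau>) m = \<sigma> (\<tau> m)"
  using autE(8)[of \<sigma>] autE(8)[of \<tau>] by (simp add: aut_group_def BijGroup_def compose_def)

lemma G_one: "m \<in> M \<Longrightarrow> \<one>\<^bsub>G\<^esub> m = m"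
  by (simp add: aut_group_def BijGroup_def)

lemma aut_zero:
  assumes "\<sigma> \<in> carrier G" shows "\<sigma> \<zero> = \<zero>"
proof -
  have "\<sigma> \<zero> \<oplus> \<sigma> \<zero> = \<sigma> \<zero>" using autE(5)[OF assms, of \<zero> \<zero>] M_closed(2) by simp
  moreover have "\<sigma> \<zero> \<in> carrier A" using autE(2)[OF assms M_closed(2)] M_closed(1) by blast
  ultimately show ?thesis by (metis add.l_cancel_one')
qed

lemma aut_finsum:
  assumes "\<sigma> \<in> carrier G" "f \<in> I \<rightarrow> M"
  shows "\<sigma> (\<Oplus>i\<in>I. f i) = (\<Oplus>i\<in>I. \<sigma> (f i))"
  using assms(2)
proof (induction I rule: infinite_finite_induct)
  case (insert i I)
  then have f: "f \<in> I \<rightarrow> M" "f i \<in> M" by auto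
  have "f \<in> I \<rightarrow> carrier A" "f i \<in> carrier A" "(\<lambda>i. \<sigma> (f i)) \<in> I \<rightarrow> carrier A" "\<sigma> (f i) \<in> carrier A"
    using f autE(2)[OF assms(1)] M_closed(1) by (auto simp: Pi_def)
  then show ?case
    using insert f autE(5)[OF assms(1) f(2) finsum_subring_closed[OF subring_M f(1)]] by simp
qed (use aut_zero[OF assms(1)] in auto)

text \<open>For the dimension \<open>k\<close> of \<open>A\<close> over \<open>M\<close>, the tower
  from \<open>F\<close> through \<open>M\<close> to \<open>A\<close> gives
  \<open>n * k = n\<^sup>2\<close>, hence \<open>k = n\<close>. That both bases have the same size
  is the numerical input for \<open>centralizer_M\<close> and for
  \<open>ex_inducing\<close>.\<close>

lemma obtain_bases:
  obtains n e y where "has_degree F A n" "dimension n F M" "dimension n M (carrier A)"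
    "e \<in> {..<n} \<rightarrow> M" "lin_indep F {..<n} e" "M = lin_span F {..<n} e"
    "y \<in> {..<n} \<rightarrow> carrier A" "lin_indep M {..<n} y" "carrier A = lin_span M {..<n::nat} y"
proof -
  obtain n where n: "has_degree F A n" "dimension n F M"
    using maximal unfolding maximal_subfield_def by auto
  have nA: "dimension (n\<^sup>2) F (carrier A)" using n(1) unfolding has_degree_def .
  have "finite_dimension M (carrier A)"
    using finite_dimension_larger_field[OF base_subfield subfield_M F_subset_M finite_dim carrier_is_subring]
      M_closed(1) by blast
  then obtain k where k: "dimension k M (carrier A)" by blast
  have "n * k = n\<^sup>2"
    using dimension_is_inj[OF base_subfield telescopic_base[OF base_subfield subfield_M n(2) k] nA] .
  moreover have "n \<noteq> 0"
  proof
    assume "n = 0"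
    then have "M = {\<zero>}" using dimension_zero[OF base_subfield] n(2) by blast
    then show False using M_closed(3) one_nonzero by blast
  qed
  ultimately have kn: "k = n" by (simp add: power2_eq_square)
  obtain e where e: "e \<in> {..<n} \<rightarrow> carrier A" "lin_indep F {..<n} e" "M = lin_span F {..<n} e"
    using dimension_basis[OF base_subfield n(2)] by blast
  obtain y where y: "y \<in> {..<n} \<rightarrow> carrier A" "lin_indep M {..<n} y" "carrier A = lin_span M {..<n} y"
    using dimension_basis[OF subfield_M k] unfolding kn by blast
  have "e \<in> {..<n} \<rightarrow> M"
    using lin_span_base[OF subfieldE(1)[OF base_subfield] _ e(1)] e(3) by auto
  then show ?thesis using that[OF n k[unfolded kn] _ e(2,3) y] by blast
qed

lemma centralizer_M: "centralizer A M \<subseteq> M"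
proof -
  obtain n e y where b: "e \<in> {..<n} \<rightarrow> M" "lin_indep F {..<n} e"
    "y \<in> {..<n} \<rightarrow> carrier A" "carrier A = lin_span M {..<n::nat} y"
    using obtain_bases by metis
  show ?thesis
    using centralizer_subset_maximal[OF _ _ subring_M M_comm b(1) _ b(3)] b(2,4) center_eq by simp
qed

text \<open>The bound is uniform in the index set and its type is free, so that automorphisms can
  serve as indices before \<open>G\<close> is known to be finite.\<close>

lemma card_lin_indep_M_le:
  obtains n where "\<And>J (x :: 'j \<Rightarrow> 'a). finite J \<Longrightarrow> x \<in> J \<rightarrow> carrier A \<Longrightarrow> lin_indep M J x \<Longrightarrow> card J \<le> n"
proof -
  obtain n e where b: "e \<in> {..<n::nat} \<rightarrow> M" "M = lin_span F {..<n} e"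
    using obtain_bases by metis
  have e: "e \<in> {..<n} \<rightarrow> carrier A" using b(1) M_closed(1) by auto
  have "card J \<le> n" if "finite J" "x \<in> J \<rightarrow> carrier A" "lin_indep M J x" for J and x :: "'j \<Rightarrow> 'a"
    using card_lin_indep_le[OF _ that(1) subring_M e _ centralizer_M that(2,3)] b(2) center_eq by simp
  then show ?thesis using that by blast
qed

lemma ex_inducing: "\<exists>x. inducing_family A M G x"
proof -
  obtain n e y where b: "e \<in> {..<n} \<rightarrow> M" "M = lin_span F {..<n} e"
    "y \<in> {..<n} \<rightarrow> carrier A" "lin_indep M {..<n::nat} y"
    using obtain_bases by metis
  have "\<exists>x. x \<in> Units A \<and> (\<forall>m\<in>M. x \<otimes> m \<otimes> inv x = \<sigma> m)" if \<sigma>: "\<sigma> \<in> carrier G" for \<sigma>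
  proof -
    have lin: "\<sigma> (\<Oplus>i\<in>{..<n}. z i \<otimes> e i) = (\<Oplus>i\<in>{..<n}. z i \<otimes> \<sigma> (e i))"
      if z: "z \<in> {..<n} \<rightarrow> ring_center A" for z
    proof -
      have zM: "z i \<in> F" "z i \<in> M" "e i \<in> M" if "i \<in> {..<n}" for i
        using z b(1) that center_eq F_subset_M by auto
      have "\<sigma> (\<Oplus>i\<in>{..<n}. z i \<otimes> e i) = (\<Oplus>i\<in>{..<n}. \<sigma> (z i \<otimes> e i))"
        using zM M_closed(6) by (intro aut_finsum[OF \<sigma>]) auto
      also have "\<dots> = (\<Oplus>i\<in>{..<n}. z i \<otimes> \<sigma> (e i))"
      proof (intro finsum_cong')
        show "(\<lambda>i. z i \<otimes> \<sigma> (e i)) \<in> {..<n} \<rightarrow> carrier A"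
          using zM autE(2)[OF \<sigma>] M_closed(1,6) by blast
        show "\<sigma> (z i \<otimes> e i) = z i \<otimes> \<sigma> (e i)" if "i \<in> {..<n}" for i
          using zM[OF that] autE(4,7)[OF \<sigma>] by simp
      qed simp
      finally show ?thesis .
    qed
    have \<sigma>M: "\<sigma> \<in> M \<rightarrow> M" using autE(2)[OF \<sigma>] by blast
    have sp: "M \<subseteq> lin_span (ring_center A) {..<n} e" using b(2) center_eq by simp
    obtain x where x: "x \<in> carrier A" "x \<noteq> \<zero>" "\<And>m. m \<in> M \<Longrightarrow> x \<otimes> m = \<sigma> m \<otimes> x"
    proof (rule skolem_noether_maximal[OF _ _ subring_M b(1) sp centralizer_M b(3,4) _ \<sigma>M
          autE(4)[OF \<sigma>] autE(6)[OF \<sigma>] lin])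
    qed (simp, simp, simp, assumption+, rule that, assumption+)
    have "x \<otimes> m \<otimes> inv x = \<sigma> m" if m: "m \<in> M" for m
    proof -
      have "\<sigma> m \<in> carrier A" using autE(2)[OF \<sigma> m] M_closed(1) by blast
      then show ?thesis using x(3)[OF m] inv_nonzero[OF x(1,2)] x(1) by (simp add: m_assoc)
    qed
    then show ?thesis using x(1,2) division by blast
  qed
  then show ?thesis unfolding inducing_family_def by metis
qed

end

section \<open>Independence of the inducing elements and finiteness of the group\<close>

locale induced_crossed_product = maximal_subfield_algebra F A M for F and A (structure) and M +
  fixes x
  assumes inducing: "inducing_family A M G x"
begin

lemma x_carrier: "\<sigma> \<in> carrier G \<Longrightarrow> x \<sigma> \<in> carrier A"
  and x_nonzero: "\<sigma> \<in> carrier G \<Longrightarrow> x \<sigma> \<noteq> \<zero>"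
  using inducing division unfolding inducing_family_def by auto

lemma x_comm:
  assumes "\<sigma> \<in> carrier G" "m \<in> M"
  shows "x \<sigma> \<otimes> m = \<sigma> m \<otimes> x \<sigma>"
proof -
  have m: "m \<in> carrier A" using assms(2) M_closed(1) by blast
  note i = inv_nonzero[OF x_carrier[OF assms(1)] x_nonzero[OF assms(1)]]
  have "\<sigma> m \<otimes> x \<sigma> = (x \<sigma> \<otimes> m \<otimes> inv (x \<sigma>)) \<otimes> x \<sigma>"
    using inducing assms unfolding inducing_family_def by simp
  also have "\<dots> = x \<sigma> \<otimes> m" using i m x_carrier[OF assms(1)] by (simp add: m_assoc)
  finally show ?thesis by simp
qed

text \<open>Only finite subsets are meaningful at this stage: \<open>finsum\<close> over an infinite
  set is \<open>\<zero>\<close> by convention, and \<open>finite_G\<close> is derived from this very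
  lemma.\<close>

lemma lin_indep_x_subset:
  assumes "finite S" "S \<subseteq> carrier G"
  shows "lin_indep M S x"
proof (rule lin_indep_inducing[OF assms(1) subring_M M_inv M_comm])
  show "S \<subseteq> M \<rightarrow>\<^sub>E M" using autE(1) assms(2) by blast
  show "\<sigma> (m \<otimes> n) = \<sigma> m \<otimes> \<sigma> n" if "\<sigma> \<in> S" "m \<in> M" "n \<in> M" for \<sigma> m n
    using autE(4) assms(2) that by blast
  show "x \<in> S \<rightarrow> carrier A - {\<zero>}" using x_carrier x_nonzero assms(2) by blast
  show "x \<sigma> \<otimes> m = \<sigma> m \<otimes> x \<sigma>" if "\<sigma> \<in> S" "m \<in> M" for \<sigma> m
    using x_comm assms(2) that by blast
qed auto

lemma finite_G: "finite (carrier G)"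
proof -
  obtain n where n: "\<And>J (x :: ('a \<Rightarrow> 'a) \<Rightarrow> 'a). finite J \<Longrightarrow> x \<in> J \<rightarrow> carrier A \<Longrightarrow>
      lin_indep M J x \<Longrightarrow> card J \<le> n"
    using card_lin_indep_M_le by blast
  have "card S \<le> n" if "S \<subseteq> carrier G" "finite S" for S
    using n[OF that(2) _ lin_indep_x_subset[OF that(2,1)]] x_carrier that(1) by blast
  then show ?thesis using finite_if_finite_subsets_card_bdd by blast
qed

lemma lin_indep_x: "lin_indep M (carrier G) x"
  using lin_indep_x_subset[OF finite_G] by simp

end

subsection \<open>The crossed product attached to a maximal subfield\<close>

context induced_crossed_product
begin

definition cocycle :: "('a \<Rightarrow> 'a) \<Rightarrow> ('a \<Rightarrow> 'a) \<Rightarrow> 'a" where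
  "cocycle \<sigma> \<tau> = x \<sigma> \<otimes> x \<tau> \<otimes> inv (x (\<sigma> \<otimes>\<^bsub>G\<^esub> \<tau>))"

abbreviation "B \<equiv> M_of_G A M G x"

lemma M_carrier: "m \<in> M \<Longrightarrow> m \<in> carrier A"
  using M_closed(1) by blast

lemma x_inv:
  assumes "\<sigma> \<in> carrier G"
  shows "inv (x \<sigma>) \<in> carrier A" "inv (x \<sigma>) \<otimes> x \<sigma> = \<one>" "x \<sigma> \<otimes> inv (x \<sigma>) = \<one>"
  using inv_nonzero[OF x_carrier[OF assms] x_nonzero[OF assms]] by auto

lemma cocycle_carrier:
  "\<sigma> \<in> carrier G \<Longrightarrow> \<tau> \<in> carrier G \<Longrightarrow> cocycle \<sigma> \<tau> \<in> carrier A"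
  unfolding cocycle_def using x_carrier x_inv(1) by simp

lemma x_mult:
  assumes "\<sigma> \<in> carrier G" "\<tau> \<in> carrier G"
  shows "x \<sigma> \<otimes> x \<tau> = cocycle \<sigma> \<tau> \<otimes> x (\<sigma> \<otimes>\<^bsub>G\<^esub> \<tau>)"
  unfolding cocycle_def using assms x_carrier x_inv[of "\<sigma> \<otimes>\<^bsub>G\<^esub> \<tau>"] by (simp add: m_assoc)

lemma cocycle_nonzero:
  assumes "\<sigma> \<in> carrier G" "\<tau> \<in> carrier G"
  shows "cocycle \<sigma> \<tau> \<noteq> \<zero>"
proof
  assume "cocycle \<sigma> \<tau> = \<zero>"
  then have "x \<sigma> \<otimes> x \<tau> = \<zero>" using x_mult[OF assms] x_carrier assms by simp
  then show False using integral_skew x_carrier x_nonzero assms by blast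
qed

text \<open>\<open>x \<sigma> \<otimes> x \<tau>\<close> and the value of \<open>x\<close> at the
  product induce the same automorphism of \<open>M\<close>. Their quotient therefore centralizes
  \<open>M\<close>, which is its own centralizer.\<close>

lemma cocycle_M:
  assumes "\<sigma> \<in> carrier G" "\<tau> \<in> carrier G"
  shows "cocycle \<sigma> \<tau> \<in> M"
proof -
  let ?u = "x (\<sigma> \<otimes>\<^bsub>G\<^esub> \<tau>)"
  have st: "\<sigma> \<otimes>\<^bsub>G\<^esub> \<tau> \<in> carrier G" using assms by simp
  note u = x_carrier[OF st] x_inv[OF st]
  note xs = x_carrier[OF assms(1)] x_carrier[OF assms(2)]
  have "cocycle \<sigma> \<tau> \<otimes> m = m \<otimes> cocycle \<sigma> \<tau>" if m: "m \<in> M" for m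
  proof -
    \<comment> \<open>Moving \<open>m\<close> leftwards through the cocycle, \<open>inv ?u\<close>
      turns it into \<open>k\<close>, and \<open>x \<tau>\<close> followed by
      \<open>x \<sigma>\<close> turns \<open>k\<close> back into \<open>m\<close>.\<close>
    obtain k where k: "k \<in> M" "m = (\<sigma> \<otimes>\<^bsub>G\<^esub> \<tau>) k"
      using autE(3)[OF st] m unfolding bij_betw_def by blast
    have c: "m \<in> carrier A" "k \<in> carrier A" "\<tau> k \<in> M" "\<tau> k \<in> carrier A"
      using m k M_carrier autE(2)[OF assms(2)] by auto
    have 1: "inv ?u \<otimes> m = k \<otimes> inv ?u"
    proof -
      have "inv ?u \<otimes> m = inv ?u \<otimes> (m \<otimes> ?u) \<otimes> inv ?u" using u c by (simp add: m_assoc)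
      also have "m \<otimes> ?u = ?u \<otimes> k" using x_comm[OF st k(1)] k(2) by simp
      also have "inv ?u \<otimes> (?u \<otimes> k) = k" using u c by (simp add: m_assoc[symmetric])
      finally show ?thesis .
    qed
    have 2: "x \<sigma> \<otimes> (x \<tau> \<otimes> k) = m \<otimes> (x \<sigma> \<otimes> x \<tau>)"
    proof -
      have "x \<sigma> \<otimes> (x \<tau> \<otimes> k) = (x \<sigma> \<otimes> \<tau> k) \<otimes> x \<tau>"
        unfolding x_comm[OF assms(2) k(1)] using xs c by (simp add: m_assoc)
      also have "x \<sigma> \<otimes> \<tau> k = m \<otimes> x \<sigma>"
        using x_comm[OF assms(1) c(3)] k G_mult[OF assms k(1)] by simp
      finally show ?thesis using xs c by (simp add: m_assoc)
    qed
    have "cocycle \<sigma> \<tau> \<otimes> m = x \<sigma> \<otimes> (x \<tau> \<otimes> k) \<otimes> inv ?u"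
      unfolding cocycle_def using u c xs 1 by (simp add: m_assoc)
    also have "\<dots> = m \<otimes> cocycle \<sigma> \<tau>"
      unfolding 2 cocycle_def using u c xs by (simp add: m_assoc)
    finally show ?thesis .
  qed
  then show ?thesis using centralizer_M cocycle_carrier[OF assms] unfolding centralizer_def by blast
qed

lemma x_one: "x \<one>\<^bsub>G\<^esub> \<in> M"
proof -
  have "x \<one>\<^bsub>G\<^esub> \<otimes> m = m \<otimes> x \<one>\<^bsub>G\<^esub>" if "m \<in> M" for m
    using x_comm[OF G.one_closed that] G_one[OF that] by simp
  then show ?thesis using centralizer_M x_carrier[OF G.one_closed] unfolding centralizer_def by blast
qed

text \<open>The family is arbitrary, so its value at the identity need not be \<open>\<one>\<close>.
  The inverse in \<open>cp_embed\<close> thus cancels exactly this value, which is why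
  \<open>left_comb_embed\<close> returns \<open>m\<close>.\<close>

lemma cocycle_one: "cocycle \<one>\<^bsub>G\<^esub> \<one>\<^bsub>G\<^esub> = x \<one>\<^bsub>G\<^esub>"
  unfolding cocycle_def using x_carrier x_inv[OF G.one_closed] by (simp add: m_assoc)

text \<open>Both sides are the coefficient of
  \<open>x \<sigma> \<otimes> x \<tau> \<otimes> x \<rho>\<close> at \<open>?u\<close>, computed
  with the two bracketings; \<open>?u\<close> is invertible and cancels.\<close>

lemma cocycle_identity:
  assumes "\<sigma> \<in> carrier G" "\<tau> \<in> carrier G" "\<rho> \<in> carrier G"
  shows "cocycle \<sigma> \<tau> \<otimes> cocycle (\<sigma> \<otimes>\<^bsub>G\<^esub> \<tau>) \<rho> = cocycle \<sigma> (\<tau> \<otimes>\<^bsub>G\<^esub> \<rho>) \<otimes> \<sigma> (cocycle \<tau> \<rho>)"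
proof -
  let ?u = "x (\<sigma> \<otimes>\<^bsub>G\<^esub> (\<tau> \<otimes>\<^bsub>G\<^esub> \<rho>))"
  have st: "\<sigma> \<otimes>\<^bsub>G\<^esub> \<tau> \<in> carrier G" "\<tau> \<otimes>\<^bsub>G\<^esub> \<rho> \<in> carrier G" "\<sigma> \<otimes>\<^bsub>G\<^esub> (\<tau> \<otimes>\<^bsub>G\<^esub> \<rho>) \<in> carrier G"
    using assms by auto
  note u = x_carrier[OF st(3)] x_inv[OF st(3)]
  note c = x_carrier[OF assms(1)] x_carrier[OF assms(2)] x_carrier[OF assms(3)]
    cocycle_carrier[OF assms(1,2)] cocycle_carrier[OF st(1) assms(3)] cocycle_carrier[OF assms(1) st(2)]
    cocycle_carrier[OF assms(2,3)] M_carrier[OF autE(2)[OF assms(1) cocycle_M[OF assms(2,3)]]]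
    x_carrier[OF st(1)] x_carrier[OF st(2)]
  let ?l = "cocycle \<sigma> \<tau> \<otimes> cocycle (\<sigma> \<otimes>\<^bsub>G\<^esub> \<tau>) \<rho>"
  let ?r = "cocycle \<sigma> (\<tau> \<otimes>\<^bsub>G\<^esub> \<rho>) \<otimes> \<sigma> (cocycle \<tau> \<rho>)"
  have "?l \<otimes> ?u = cocycle \<sigma> \<tau> \<otimes> (x (\<sigma> \<otimes>\<^bsub>G\<^esub> \<tau>) \<otimes> x \<rho>)"
    using x_mult[OF st(1) assms(3)] assms c u by (simp add: m_assoc G.m_assoc)
  also have "\<dots> = x \<sigma> \<otimes> x \<tau> \<otimes> x \<rho>"
    using x_mult[OF assms(1,2)] c by (simp add: m_assoc)
  also have "\<dots> = x \<sigma> \<otimes> cocycle \<tau> \<rho> \<otimes> x (\<tau> \<otimes>\<^bsub>G\<^esub> \<rho>)"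
    using x_mult[OF assms(2,3)] c by (simp add: m_assoc)
  also have "\<dots> = \<sigma> (cocycle \<tau> \<rho>) \<otimes> (x \<sigma> \<otimes> x (\<tau> \<otimes>\<^bsub>G\<^esub> \<rho>))"
    unfolding x_comm[OF assms(1) cocycle_M[OF assms(2,3)]] using c by (simp add: m_assoc)
  also have "\<dots> = (\<sigma> (cocycle \<tau> \<rho>) \<otimes> cocycle \<sigma> (\<tau> \<otimes>\<^bsub>G\<^esub> \<rho>)) \<otimes> ?u"
    unfolding x_mult[OF assms(1) st(2)] using c u by (simp add: m_assoc)
  also have "\<sigma> (cocycle \<tau> \<rho>) \<otimes> cocycle \<sigma> (\<tau> \<otimes>\<^bsub>G\<^esub> \<rho>) = ?r"
    by (rule M_comm[OF autE(2)[OF assms(1) cocycle_M[OF assms(2,3)]] cocycle_M[OF assms(1) st(2)]])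
  finally have "?l \<otimes> ?u \<otimes> inv ?u = ?r \<otimes> ?u \<otimes> inv ?u" by simp
  then show ?thesis using c u by (simp add: m_assoc)
qed

lemma factor_set_cocycle: "factor_set L G cocycle"
  unfolding factor_set_def subfield.subfield_Units[OF subfield_M]
  using cocycle_M cocycle_nonzero cocycle_identity by simp

section \<open>The span of the inducing elements as a crossed product\<close>

lemma left_comb_carrier: "f \<in> carrier G \<rightarrow> M \<Longrightarrow> left_comb A G x f \<in> carrier A"
  unfolding left_comb_def using x_carrier M_carrier by (intro finsum_closed) auto

text \<open>\<open>M_of_G\<close> admits only extensional coefficient functions, whereas
  \<open>lin_span\<close> admits all; restricting a function to \<open>G\<close> does not affect the
  sum.\<close>

lemma B_eq: "B = lin_span M (carrier G) x"
proof (intro equalityI subsetI)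
  fix b assume "b \<in> B"
  then show "b \<in> lin_span M (carrier G) x"
    unfolding M_of_G_def left_comb_def lin_span_def by auto
next
  fix b assume "b \<in> lin_span M (carrier G) x"
  then obtain c where c: "c \<in> carrier G \<rightarrow> M" "b = (\<Oplus>\<sigma>\<in>carrier G. c \<sigma> \<otimes> x \<sigma>)"
    unfolding lin_span_def by blast
  have cC: "c \<sigma> \<in> carrier A" if "\<sigma> \<in> carrier G" for \<sigma>
    using M_carrier[OF funcset_mem[OF c(1) that]] .
  have "b = left_comb A G x (restrict c (carrier G))"
    unfolding left_comb_def c(2) using cC x_carrier by (intro finsum_cong') auto
  moreover have "restrict c (carrier G) \<in> carrier G \<rightarrow>\<^sub>E M" using c(1) by auto
  ultimately show "b \<in> B" unfolding M_of_G_def by simp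
qed

lemma dimension_B: "dimension (card (carrier G)) M B"
  unfolding B_eq using dimension_lin_span[OF subfield_M finite_G _ lin_indep_x] x_carrier by blast

lemmas B_space = space_subgroup_props[OF subfield_M dimension_B]

lemma x_in_B: "\<sigma> \<in> carrier G \<Longrightarrow> x \<sigma> \<in> B"
  unfolding B_eq using lin_span_base[OF subring_M finite_G] x_carrier by blast

text \<open>For given \<open>\<sigma>\<close> and \<open>\<rho>\<close> exactly one
  \<open>\<tau>\<close> has product \<open>\<rho>\<close> with \<open>\<sigma>\<close>. The summand
  in the crossed product is the coefficient of the product of the single terms at
  \<open>\<sigma>\<close> and at this \<open>\<tau>\<close>.\<close>

lemma cp_mult_term:
  assumes "f \<in> carrier G \<rightarrow> M" "g \<in> carrier G \<rightarrow> M" "\<sigma> \<in> carrier G" "\<rho> \<in> carrier G"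
  shows "f \<sigma> \<otimes> \<sigma> (g (inv\<^bsub>G\<^esub> \<sigma> \<otimes>\<^bsub>G\<^esub> \<rho>)) \<otimes> cocycle \<sigma> (inv\<^bsub>G\<^esub> \<sigma> \<otimes>\<^bsub>G\<^esub> \<rho>) \<in> M"
    "f \<sigma> \<otimes> \<sigma> (g (inv\<^bsub>G\<^esub> \<sigma> \<otimes>\<^bsub>G\<^esub> \<rho>)) \<otimes> cocycle \<sigma> (inv\<^bsub>G\<^esub> \<sigma> \<otimes>\<^bsub>G\<^esub> \<rho>) \<otimes> x \<rho>
      = f \<sigma> \<otimes> x \<sigma> \<otimes> (g (inv\<^bsub>G\<^esub> \<sigma> \<otimes>\<^bsub>G\<^esub> \<rho>) \<otimes> x (inv\<^bsub>G\<^esub> \<sigma> \<otimes>\<^bsub>G\<^esub> \<rho>))"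
proof -
  define \<tau> where "\<tau> = inv\<^bsub>G\<^esub> \<sigma> \<otimes>\<^bsub>G\<^esub> \<rho>"
  have \<tau>: "\<tau> \<in> carrier G" "\<sigma> \<otimes>\<^bsub>G\<^esub> \<tau> = \<rho>"
    unfolding \<tau>_def using assms by (auto simp: G.m_assoc[symmetric])
  have m: "f \<sigma> \<in> M" "g \<tau> \<in> M" "\<sigma> (g \<tau>) \<in> M" "cocycle \<sigma> \<tau> \<in> M"
    using assms \<tau> autE(2)[OF assms(3)] cocycle_M by auto
  then show "f \<sigma> \<otimes> \<sigma> (g (inv\<^bsub>G\<^esub> \<sigma> \<otimes>\<^bsub>G\<^esub> \<rho>)) \<otimes> cocycle \<sigma> (inv\<^bsub>G\<^esub> \<sigma> \<otimes>\<^bsub>G\<^esub> \<rho>) \<in> M"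
    unfolding \<tau>_def[symmetric] using M_closed(6) by blast
  note c = m[THEN M_carrier] x_carrier[OF assms(3)] x_carrier[OF \<tau>(1)] x_carrier[OF assms(4)]
  have "f \<sigma> \<otimes> \<sigma> (g \<tau>) \<otimes> cocycle \<sigma> \<tau> \<otimes> x \<rho> = f \<sigma> \<otimes> (\<sigma> (g \<tau>) \<otimes> (cocycle \<sigma> \<tau> \<otimes> x \<rho>))"
    using c by (simp add: m_assoc)
  also have "cocycle \<sigma> \<tau> \<otimes> x \<rho> = x \<sigma> \<otimes> x \<tau>"
    using x_mult[OF assms(3) \<tau>(1)] \<tau>(2) by simp
  also have "\<sigma> (g \<tau>) \<otimes> (x \<sigma> \<otimes> x \<tau>) = x \<sigma> \<otimes> g \<tau> \<otimes> x \<tau>"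
    unfolding x_comm[OF assms(3) m(2)] using c by (simp add: m_assoc)
  finally show "f \<sigma> \<otimes> \<sigma> (g (inv\<^bsub>G\<^esub> \<sigma> \<otimes>\<^bsub>G\<^esub> \<rho>)) \<otimes> cocycle \<sigma> (inv\<^bsub>G\<^esub> \<sigma> \<otimes>\<^bsub>G\<^esub> \<rho>) \<otimes> x \<rho>
      = f \<sigma> \<otimes> x \<sigma> \<otimes> (g (inv\<^bsub>G\<^esub> \<sigma> \<otimes>\<^bsub>G\<^esub> \<rho>) \<otimes> x (inv\<^bsub>G\<^esub> \<sigma> \<otimes>\<^bsub>G\<^esub> \<rho>))"
    unfolding \<tau>_def[symmetric] using c by (simp add: m_assoc)
qed

lemma left_comb_mult:
  assumes "f \<in> carrier G \<rightarrow> M" "g \<in> carrier G \<rightarrow> M"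
  shows "f \<otimes>\<^bsub>crossed_product L G cocycle\<^esub> g \<in> carrier G \<rightarrow>\<^sub>E M" (is "?p \<in> _")
    and "left_comb A G x (f \<otimes>\<^bsub>crossed_product L G cocycle\<^esub> g)
      = left_comb A G x f \<otimes> left_comb A G x g"
proof -
  let ?t = "\<lambda>\<sigma> \<rho>. f \<sigma> \<otimes> \<sigma> (g (inv\<^bsub>G\<^esub> \<sigma> \<otimes>\<^bsub>G\<^esub> \<rho>)) \<otimes> cocycle \<sigma> (inv\<^bsub>G\<^esub> \<sigma> \<otimes>\<^bsub>G\<^esub> \<rho>)"
  let ?g = "\<lambda>\<tau>. g \<tau> \<otimes> x \<tau>"
  have p: "?p = (\<lambda>\<rho>\<in>carrier G. \<Oplus>\<sigma>\<in>carrier G. ?t \<sigma> \<rho>)"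
  proof -
    \<comment> \<open>The crossed product adds its coefficients in \<open>L\<close>, whereas
      \<open>left_comb\<close> adds in \<open>A\<close>.\<close>
    have "finsum L (\<lambda>\<sigma>. ?t \<sigma> \<rho>) (carrier G) = finsum A (\<lambda>\<sigma>. ?t \<sigma> \<rho>) (carrier G)"
      if "\<rho> \<in> carrier G" for \<rho>
      using cp_mult_term(1)[OF assms _ that] by (intro finsum_consistent[OF subring_M]) auto
    then show ?thesis unfolding crossed_product_def by (auto simp: restrict_def)
  qed
  show "?p \<in> carrier G \<rightarrow>\<^sub>E M"
    unfolding p using cp_mult_term(1)[OF assms]
    by (auto intro!: finsum_subring_closed[OF subring_M])
  have tC: "?t \<sigma> \<rho> \<in> carrier A" if "\<sigma> \<in> carrier G" "\<rho> \<in> carrier G" for \<sigma> \<rho>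
    using cp_mult_term(1)[OF assms that] M_carrier by blast
  have gC: "?g \<tau> \<in> carrier A" if "\<tau> \<in> carrier G" for \<tau>
    using that assms(2) M_carrier x_carrier by auto
  have fC: "f \<sigma> \<otimes> x \<sigma> \<in> carrier A" if "\<sigma> \<in> carrier G" for \<sigma>
    using that assms(1) M_carrier x_carrier by auto
  have "left_comb A G x ?p = (\<Oplus>\<rho>\<in>carrier G. \<Oplus>\<sigma>\<in>carrier G. ?t \<sigma> \<rho> \<otimes> x \<rho>)"
    unfolding left_comb_def
  proof (intro finsum_cong')
    show "?p \<rho> \<otimes> x \<rho> = (\<Oplus>\<sigma>\<in>carrier G. ?t \<sigma> \<rho> \<otimes> x \<rho>)" if "\<rho> \<in> carrier G" for \<rho>
      unfolding p using that tC x_carrier finite_G by (simp add: finsum_ldistr Pi_def)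
  qed (use tC x_carrier in \<open>auto intro!: finsum_closed\<close>)
  also have "\<dots> = (\<Oplus>\<sigma>\<in>carrier G. \<Oplus>\<rho>\<in>carrier G. ?t \<sigma> \<rho> \<otimes> x \<rho>)"
    using tC x_carrier finite_G by (intro finsum_swap) auto
  also have "\<dots> = (\<Oplus>\<sigma>\<in>carrier G. f \<sigma> \<otimes> x \<sigma> \<otimes> left_comb A G x g)"
  proof (intro finsum_cong')
    fix \<sigma> assume \<sigma>: "\<sigma> \<in> carrier G"
    \<comment> \<open>For fixed \<open>\<sigma>\<close> this map permutes \<open>G\<close>, so
      reindexing by it turns the inner sum into \<open>left_comb A G x g\<close>.\<close>
    let ?s = "\<lambda>\<rho>. inv\<^bsub>G\<^esub> \<sigma> \<otimes>\<^bsub>G\<^esub> \<rho>"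
    have s: "?s ` carrier G = carrier G" "inj_on ?s (carrier G)"
    proof -
      show "inj_on ?s (carrier G)" using \<sigma> by (auto simp: inj_on_def)
      have "\<tau> \<in> ?s ` carrier G" if "\<tau> \<in> carrier G" for \<tau>
        using that \<sigma> by (intro image_eqI[of _ _ "\<sigma> \<otimes>\<^bsub>G\<^esub> \<tau>"]) (auto simp: G.m_assoc[symmetric])
      then show "?s ` carrier G = carrier G" using \<sigma> by auto
    qed
    have "(\<Oplus>\<rho>\<in>carrier G. ?t \<sigma> \<rho> \<otimes> x \<rho>) = (\<Oplus>\<rho>\<in>carrier G. f \<sigma> \<otimes> x \<sigma> \<otimes> ?g (?s \<rho>))"
      using cp_mult_term(2)[OF assms \<sigma>] fC[OF \<sigma>] gC \<sigma> by (intro finsum_cong') auto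
    also have "\<dots> = f \<sigma> \<otimes> x \<sigma> \<otimes> (\<Oplus>\<rho>\<in>carrier G. ?g (?s \<rho>))"
      using fC[OF \<sigma>] gC \<sigma> finite_G by (intro finsum_rdistr[symmetric]) auto
    also have "(\<Oplus>\<rho>\<in>carrier G. ?g (?s \<rho>)) = (\<Oplus>\<tau>\<in>?s ` carrier G. ?g \<tau>)"
      using gC s by (intro finsum_reindex[symmetric]) auto
    finally show "(\<Oplus>\<rho>\<in>carrier G. ?t \<sigma> \<rho> \<otimes> x \<rho>) = f \<sigma> \<otimes> x \<sigma> \<otimes> left_comb A G x g"
      unfolding s(1) left_comb_def .
  qed (use fC left_comb_carrier[OF assms(2)] in auto)
  also have "\<dots> = left_comb A G x f \<otimes> left_comb A G x g"
    unfolding left_comb_def[of A G x f]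
    using fC left_comb_carrier[OF assms(2)] finite_G by (intro finsum_ldistr[symmetric]) auto
  finally show "left_comb A G x ?p = left_comb A G x f \<otimes> left_comb A G x g" .
qed

lemma left_comb_embed:
  assumes "m \<in> M"
  shows "cp_embed L G cocycle m \<in> carrier G \<rightarrow>\<^sub>E M" "left_comb A G x (cp_embed L G cocycle m) = m"
proof -
  let ?c = "cp_embed L G cocycle m"
  have x1: "x \<one>\<^bsub>G\<^esub> \<noteq> \<zero>" "inv (x \<one>\<^bsub>G\<^esub>) \<in> M" using M_inv[OF x_one] x_nonzero by auto
  have c: "?c = (\<lambda>\<rho>\<in>carrier G. if \<rho> = \<one>\<^bsub>G\<^esub> then m \<otimes> inv (x \<one>\<^bsub>G\<^esub>) else \<zero>)"
    unfolding cp_embed_def cocycle_one inv_subring[OF subring_M x_one x1]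
    by (intro restrict_ext) simp
  show "?c \<in> carrier G \<rightarrow>\<^sub>E M" unfolding c using assms x1 M_closed(2,6) by auto
  have mC: "m \<in> carrier A" using assms M_carrier by blast
  have "left_comb A G x ?c = ?c \<one>\<^bsub>G\<^esub> \<otimes> x \<one>\<^bsub>G\<^esub>"
    unfolding left_comb_def c using finite_G mC x_inv(1) x_carrier by (intro finsum_single) auto
  also have "\<dots> = m" unfolding c using x_inv[OF G.one_closed] x_carrier mC by (simp add: m_assoc)
  finally show "left_comb A G x ?c = m" .
qed

lemma M_subset_B: "M \<subseteq> B"
proof
  fix m assume "m \<in> M"
  from left_comb_embed[OF this] show "m \<in> B" unfolding M_of_G_def by (metis imageI)
qed

lemma subring_B: "subring B A"
proof (rule subringI)
  show "h1 \<otimes> h2 \<in> B" if h: "h1 \<in> B" "h2 \<in> B" for h1 h2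
  proof -
    obtain f g where fg: "f \<in> carrier G \<rightarrow>\<^sub>E M" "g \<in> carrier G \<rightarrow>\<^sub>E M"
        "h1 = left_comb A G x f" "h2 = left_comb A G x g"
      using h unfolding M_of_G_def by blast
    have fg': "f \<in> carrier G \<rightarrow> M" "g \<in> carrier G \<rightarrow> M" using fg by auto
    show ?thesis unfolding fg(3,4) left_comb_mult(2)[OF fg', symmetric] M_of_G_def
      using left_comb_mult(1)[OF fg'] by (rule imageI)
  qed
qed (use B_space M_subset_B M_closed(3) in auto)

lemma left_comb_iso: "left_comb A G x \<in> ring_iso (crossed_product L G cocycle) (A\<lparr>carrier := B\<rparr>)"
  (is "_ \<in> ring_iso ?C _")
proof -
  have C: "carrier ?C = carrier G \<rightarrow>\<^sub>E M" unfolding crossed_product_def by simp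
  have "left_comb A G x \<in> ring_hom ?C (A\<lparr>carrier := B\<rparr>)"
  proof (rule ring_hom_memI)
    fix f assume f: "f \<in> carrier ?C"
    then have f': "f \<in> carrier G \<rightarrow> M" unfolding C by auto
    show "left_comb A G x f \<in> carrier (A\<lparr>carrier := B\<rparr>)" using f unfolding C M_of_G_def by simp
    fix g assume "g \<in> carrier ?C"
    then have g': "g \<in> carrier G \<rightarrow> M" unfolding C by auto
    show "left_comb A G x (f \<otimes>\<^bsub>?C\<^esub> g) = left_comb A G x f \<otimes>\<^bsub>A\<lparr>carrier := B\<rparr>\<^esub> left_comb A G x g"
      using left_comb_mult(2)[OF f' g'] by simp
    have fC: "f \<sigma> \<in> carrier A" "g \<sigma> \<in> carrier A" if "\<sigma> \<in> carrier G" for \<sigma>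
      using f' g' that M_carrier by auto
    have "left_comb A G x (f \<oplus>\<^bsub>?C\<^esub> g) = (\<Oplus>\<sigma>\<in>carrier G. f \<sigma> \<otimes> x \<sigma> \<oplus> g \<sigma> \<otimes> x \<sigma>)"
      unfolding left_comb_def crossed_product_def
      using fC x_carrier by (intro finsum_cong') (auto simp: l_distr)
    also have "\<dots> = left_comb A G x f \<oplus> left_comb A G x g"
      unfolding left_comb_def using fC x_carrier by (intro finsum_addf) auto
    finally show "left_comb A G x (f \<oplus>\<^bsub>?C\<^esub> g) = left_comb A G x f \<oplus>\<^bsub>A\<lparr>carrier := B\<rparr>\<^esub> left_comb A G x g"
      by simp
  next
    show "left_comb A G x \<one>\<^bsub>?C\<^esub> = \<one>\<^bsub>A\<lparr>carrier := B\<rparr>\<^esub>"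
      using left_comb_embed(2)[OF M_closed(3)] unfolding crossed_product_def by simp
  qed
  moreover have "bij_betw (left_comb A G x) (carrier ?C) B"
    unfolding bij_betw_def C
  proof
    show "inj_on (left_comb A G x) (carrier G \<rightarrow>\<^sub>E M)"
    proof (rule inj_onI)
      fix f g assume f: "f \<in> carrier G \<rightarrow>\<^sub>E M" and g: "g \<in> carrier G \<rightarrow>\<^sub>E M"
        and eq: "left_comb A G x f = left_comb A G x g"
      have fg: "f \<in> carrier G \<rightarrow> M" "g \<in> carrier G \<rightarrow> M" "x \<in> carrier G \<rightarrow> carrier A"
        using f g x_carrier by auto
      have "f \<sigma> = g \<sigma>" if "\<sigma> \<in> carrier G" for \<sigma>
        by (rule lin_indep_unique[OF lin_indep_x subring_M finite_G fg(3,1,2) eq[unfolded left_comb_def] that])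
      then show "f = g" using f g by (rule PiE_ext[rotated 2])
    qed
  qed (simp add: M_of_G_def)
  ultimately show ?thesis unfolding ring_iso_def by simp
qed

text \<open>The translates \<open>x \<sigma> \<otimes> b\<close> are again a basis of \<open>B\<close> over \<open>M\<close>, so that one of their
  combinations is \<open>\<one>\<close>.\<close>

lemma B_inv:
  assumes b: "b \<in> B" "b \<noteq> \<zero>"
  shows "inv b \<in> B"
proof -
  note BS = subringE[OF subring_B]
  have bC: "b \<in> carrier A" using b BS(1) by blast
  let ?y = "\<lambda>\<sigma>. x \<sigma> \<otimes> b"
  have yC: "?y \<in> carrier G \<rightarrow> carrier A" using x_carrier bC by auto
  have comb: "(\<Oplus>\<sigma>\<in>carrier G. c \<sigma> \<otimes> ?y \<sigma>) = (\<Oplus>\<sigma>\<in>carrier G. c \<sigma> \<otimes> x \<sigma>) \<otimes> b"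
    and combC: "(\<Oplus>\<sigma>\<in>carrier G. c \<sigma> \<otimes> x \<sigma>) \<in> carrier A"
    if c: "c \<in> carrier G \<rightarrow> M" for c
  proof -
    have cC: "c \<sigma> \<in> carrier A" if "\<sigma> \<in> carrier G" for \<sigma>
      using M_carrier[OF funcset_mem[OF c that]] .
    show "(\<Oplus>\<sigma>\<in>carrier G. c \<sigma> \<otimes> x \<sigma>) \<in> carrier A"
      using cC x_carrier by (intro finsum_closed) auto
    have "(\<Oplus>\<sigma>\<in>carrier G. c \<sigma> \<otimes> ?y \<sigma>) = (\<Oplus>\<sigma>\<in>carrier G. c \<sigma> \<otimes> x \<sigma> \<otimes> b)"
      using cC x_carrier bC by (intro finsum_cong') (auto simp: m_assoc)
    also have "\<dots> = (\<Oplus>\<sigma>\<in>carrier G. c \<sigma> \<otimes> x \<sigma>) \<otimes> b"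
      using cC x_carrier bC finite_G by (intro finsum_ldistr[symmetric]) auto
    finally show "(\<Oplus>\<sigma>\<in>carrier G. c \<sigma> \<otimes> ?y \<sigma>) = (\<Oplus>\<sigma>\<in>carrier G. c \<sigma> \<otimes> x \<sigma>) \<otimes> b" .
  qed
  have "lin_indep M (carrier G) ?y"
    unfolding lin_indep_def
  proof (rule ballI, rule impI)
    fix c assume c: "c \<in> carrier G \<rightarrow> M" "(\<Oplus>\<sigma>\<in>carrier G. c \<sigma> \<otimes> ?y \<sigma>) = \<zero>"
    have "(\<Oplus>\<sigma>\<in>carrier G. c \<sigma> \<otimes> x \<sigma>) = \<zero>"
      using integral_skew[OF _ combC[OF c(1)] bC] comb[OF c(1)] c(2) b(2) by auto
    then show "\<forall>\<sigma>\<in>carrier G. c \<sigma> = \<zero>" using lin_indepD[OF lin_indep_x c(1)] by blast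
  qed
  then have d: "dimension (card (carrier G)) M (lin_span M (carrier G) ?y)"
    using dimension_lin_span[OF subfield_M finite_G yC] by blast
  have "lin_span M (carrier G) ?y \<subseteq> B"
  proof
    fix v assume "v \<in> lin_span M (carrier G) ?y"
    then obtain c where c: "c \<in> carrier G \<rightarrow> M" "v = (\<Oplus>\<sigma>\<in>carrier G. c \<sigma> \<otimes> ?y \<sigma>)"
      unfolding lin_span_def by blast
    have "(\<Oplus>\<sigma>\<in>carrier G. c \<sigma> \<otimes> x \<sigma>) \<in> B" unfolding B_eq by (rule lin_spanI[OF c(1)])
    then show "v \<in> B" unfolding c(2) comb[OF c(1)] using BS(6) b(1) by blast
  qed
  then have "lin_span M (carrier G) ?y = B"
    using dimension_subset_eq[OF subfield_M dimension_B d] by blast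
  then have "\<one> \<in> lin_span M (carrier G) ?y" using BS(3) by simp
  then obtain c where c: "c \<in> carrier G \<rightarrow> M" "\<one> = (\<Oplus>\<sigma>\<in>carrier G. c \<sigma> \<otimes> ?y \<sigma>)"
    unfolding lin_span_def by blast
  \<comment> \<open>Factoring \<open>b\<close> out on the right exhibits a left inverse inside
    \<open>B\<close>; it equals \<open>inv b\<close> because \<open>b\<close> is invertible in
    \<open>A\<close>.\<close>
  define u where "u = (\<Oplus>\<sigma>\<in>carrier G. c \<sigma> \<otimes> x \<sigma>)"
  have u: "u \<in> B" "u \<in> carrier A" "u \<otimes> b = \<one>"
    using lin_spanI[OF c(1)] combC[OF c(1)] comb[OF c(1)] c(2) unfolding u_def B_eq by auto
  note i = inv_nonzero[OF bC b(2)]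
  have "inv b = (u \<otimes> b) \<otimes> inv b" using u i by simp
  also have "\<dots> = u" using u(2) i bC by (simp add: m_assoc)
  finally show ?thesis using u(1) by simp
qed

section \<open>M(G) as a central division algebra over the fixed field\<close>

abbreviation "BR \<equiv> A\<lparr>carrier := B\<rparr>"

sublocale B: skew_field BR
  by (rule skew_field_subring[OF subring_B B_inv])

sublocale L: skew_field L
  by (rule skew_field_subring[OF subring_M M_inv])

lemma Z_iff: "z \<in> Z \<longleftrightarrow> z \<in> M \<and> (\<forall>\<sigma>\<in>carrier G. \<sigma> z = z)"
  unfolding fixed_field_def by simp

lemma Z_subset_M: "Z \<subseteq> M" and F_subset_Z: "F \<subseteq> Z"
  using Z_iff F_subset_M autE(7) by auto

lemma subring_Z: "subring Z A"
proof (rule subringI)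
  show "Z \<subseteq> carrier A" using Z_subset_M M_closed(1) by blast
  show "\<one> \<in> Z" using Z_iff M_closed(3) autE(6) by blast
  fix h assume h: "h \<in> Z"
  have hM: "h \<in> M" "\<And>\<sigma>. \<sigma> \<in> carrier G \<Longrightarrow> \<sigma> h = h" using h Z_iff by auto
  have "\<sigma> (\<ominus> h) = \<ominus> h" if \<sigma>: "\<sigma> \<in> carrier G" for \<sigma>
  proof -
    have "\<sigma> h \<oplus> \<sigma> (\<ominus> h) = \<zero>"
      using autE(5)[OF \<sigma> hM(1) M_closed(5)[OF hM(1)]] aut_zero[OF \<sigma>] M_carrier[OF hM(1)]
      by (simp add: r_neg)
    then show ?thesis
      using hM \<sigma> M_carrier[OF hM(1)] M_carrier[OF autE(2)[OF \<sigma> M_closed(5)[OF hM(1)]]]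
      by (metis add.inv_equality add.m_comm)
  qed
  then show "\<ominus> h \<in> Z" using Z_iff M_closed(5)[OF hM(1)] by blast
  fix k assume k: "k \<in> Z"
  have kM: "k \<in> M" "\<And>\<sigma>. \<sigma> \<in> carrier G \<Longrightarrow> \<sigma> k = k" using k Z_iff by auto
  show "h \<otimes> k \<in> Z" using Z_iff M_closed(6) autE(4) hM kM by metis
  show "h \<oplus> k \<in> Z" using Z_iff M_closed(7) autE(5) hM kM by metis
qed

lemma Z_inv:
  assumes "z \<in> Z" "z \<noteq> \<zero>"
  shows "inv z \<in> Z"
proof -
  have z: "z \<in> M" "\<And>\<sigma>. \<sigma> \<in> carrier G \<Longrightarrow> \<sigma> z = z" using assms Z_iff by auto
  note i = inv_nonzero[OF M_carrier[OF z(1)] assms(2)]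
  note iM = M_inv[OF z(1) assms(2)]
  have "\<sigma> (inv z) = inv z" if \<sigma>: "\<sigma> \<in> carrier G" for \<sigma>
  proof -
    have s: "\<sigma> (inv z) \<in> carrier A" using autE(2)[OF \<sigma> iM] M_carrier by blast
    have "z \<otimes> \<sigma> (inv z) = \<one>"
      using autE(4)[OF \<sigma> z(1) iM] z(2)[OF \<sigma>] autE(6)[OF \<sigma>] i by simp
    then have "inv z \<otimes> (z \<otimes> \<sigma> (inv z)) = inv z" using i by simp
    then show ?thesis using i s M_carrier[OF z(1)] by (simp add: m_assoc[symmetric])
  qed
  then show ?thesis using Z_iff iM by blast
qed

lemma Z_comm: "a \<in> Z \<Longrightarrow> b \<in> Z \<Longrightarrow> a \<otimes> b = b \<otimes> a"
  using M_comm Z_subset_M by blast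

lemma subfield_Z: "subfield Z A"
  by (rule subfield_of_inv_closed[OF subring_Z Z_inv Z_comm])

lemma subfield_in_subring:
  assumes "subring S A" "\<And>a. a \<in> S \<Longrightarrow> a \<noteq> \<zero> \<Longrightarrow> inv a \<in> S" "subfield K A" "K \<subseteq> S"
  shows "subfield K (A\<lparr>carrier := S\<rparr>)"
proof -
  interpret S: skew_field "A\<lparr>carrier := S\<rparr>" by (rule skew_field_subring[OF assms(1,2)])
  have K: "field (A\<lparr>carrier := K\<rparr>)" using subfield_iff(2)[OF assms(3)] .
  then show ?thesis using S.subfield_iff(1)[of K] assms(4) by simp
qed

text \<open>Enlarging the base from \<open>F\<close> to the fixed field loses no automorphism, as
  all of them fix it by its definition. So the Galois group of \<open>M\<close> over the centre of
  M(G) is still \<open>G\<close>.\<close>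

lemma aut_group_Z: "aut_group Z L = G"
proof -
  have "{\<sigma> \<in> ring_iso L L \<inter> extensional M. \<forall>z\<in>Z. \<sigma> z = z}
      = {\<sigma> \<in> ring_iso L L \<inter> extensional M. \<forall>z\<in>F. \<sigma> z = z}" (is "?S = ?T")
  proof (intro equalityI subsetI)
    fix \<sigma> assume "\<sigma> \<in> ?S" then show "\<sigma> \<in> ?T" using F_subset_Z by blast
  next
    fix \<sigma> assume s: "\<sigma> \<in> ?T"
    then have "\<sigma> \<in> carrier G" unfolding aut_group_def by simp
    then show "\<sigma> \<in> ?S" using s Z_iff by blast
  qed
  then show ?thesis unfolding aut_group_def by simp
qed

text \<open>A central element commutes with \<open>M\<close>, so it lies in \<open>M\<close>;
  commuting with \<open>x \<sigma>\<close> then means being fixed by \<open>\<sigma>\<close>.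
  Conversely a fixed element of \<open>M\<close> passes through every
  \<open>c \<sigma> \<otimes> x \<sigma>\<close>.\<close>

lemma center_B: "ring_center BR = Z"
proof (intro equalityI subsetI)
  fix b assume "b \<in> ring_center BR"
  then have b: "b \<in> B" "\<And>y. y \<in> B \<Longrightarrow> b \<otimes> y = y \<otimes> b" unfolding ring_center_def by auto
  have bC: "b \<in> carrier A" using b(1) subringE(1)[OF subring_B] by blast
  then have bM: "b \<in> M" using b M_subset_B centralizer_M unfolding centralizer_def by blast
  have "\<sigma> b = b" if \<sigma>: "\<sigma> \<in> carrier G" for \<sigma>
  proof -
    have s: "\<sigma> b \<in> carrier A" using autE(2)[OF \<sigma> bM] M_carrier by blast
    have "\<sigma> b \<otimes> x \<sigma> = b \<otimes> x \<sigma>" using x_comm[OF \<sigma> bM] b(2)[OF x_in_B[OF \<sigma>]] by simp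
    then have "\<sigma> b \<otimes> x \<sigma> \<otimes> inv (x \<sigma>) = b \<otimes> x \<sigma> \<otimes> inv (x \<sigma>)" by simp
    then show ?thesis using s bC x_inv[OF \<sigma>] x_carrier[OF \<sigma>] by (simp add: m_assoc)
  qed
  then show "b \<in> Z" using Z_iff bM by blast
next
  fix z assume z: "z \<in> Z"
  then have zM: "z \<in> M" "\<And>\<sigma>. \<sigma> \<in> carrier G \<Longrightarrow> \<sigma> z = z" using Z_iff by auto
  have zC: "z \<in> carrier A" using zM(1) M_carrier by blast
  have "z \<otimes> b = b \<otimes> z" if b: "b \<in> B" for b
  proof -
    obtain c where c: "c \<in> carrier G \<rightarrow> M" "b = (\<Oplus>\<sigma>\<in>carrier G. c \<sigma> \<otimes> x \<sigma>)"
      using b unfolding B_eq lin_span_def by blast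
    have cM: "c \<sigma> \<in> M" "c \<sigma> \<in> carrier A" if "\<sigma> \<in> carrier G" for \<sigma>
      using funcset_mem[OF c(1) that] M_carrier by auto
    have "z \<otimes> b = (\<Oplus>\<sigma>\<in>carrier G. z \<otimes> (c \<sigma> \<otimes> x \<sigma>))"
      unfolding c(2) using cM x_carrier zC finite_G by (intro finsum_rdistr) auto
    also have "\<dots> = (\<Oplus>\<sigma>\<in>carrier G. c \<sigma> \<otimes> x \<sigma> \<otimes> z)"
    proof (intro finsum_cong')
      fix \<sigma> assume \<sigma>: "\<sigma> \<in> carrier G"
      have "z \<otimes> (c \<sigma> \<otimes> x \<sigma>) = (c \<sigma> \<otimes> z) \<otimes> x \<sigma>"
        using M_comm[OF zM(1) cM(1)[OF \<sigma>]] cM(2)[OF \<sigma>] zC x_carrier[OF \<sigma>]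
        by (simp add: m_assoc[symmetric])
      also have "\<dots> = c \<sigma> \<otimes> x \<sigma> \<otimes> z"
        using x_comm[OF \<sigma> zM(1)] zM(2)[OF \<sigma>] cM(2)[OF \<sigma>] zC x_carrier[OF \<sigma>] by (simp add: m_assoc)
      finally show "z \<otimes> (c \<sigma> \<otimes> x \<sigma>) = c \<sigma> \<otimes> x \<sigma> \<otimes> z" .
    qed (use cM x_carrier zC in auto)
    also have "\<dots> = b \<otimes> z"
      unfolding c(2) using cM x_carrier zC finite_G by (intro finsum_ldistr[symmetric]) auto
    finally show ?thesis .
  qed
  then show "z \<in> ring_center BR" using zM(1) M_subset_B unfolding ring_center_def by auto
qed

text \<open>Takes the place of Artin's theorem on fixed fields. In \<open>BR\<close>, with centre
  \<open>Z\<close>, the family \<open>x\<close> is a basis over \<open>M\<close>: independence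
  allows at most [M:Z] members, and spanning requires at least as many.\<close>

lemma M_over_Z: "dimension (card (carrier G)) Z M"
proof -
  obtain n where "dimension n F M" using maximal unfolding maximal_subfield_def by auto
  then have "finite_dimension Z M"
    using finite_dimension_larger_field[OF base_subfield subfield_Z F_subset_Z _ subring_M]
      finite_dimensionI M_closed(6) Z_subset_M by blast
  then obtain l where l: "dimension l Z M" by blast
  obtain e where e: "e \<in> {..<l} \<rightarrow> carrier A" "lin_indep Z {..<l} e" "M = lin_span Z {..<l} e"
    using dimension_basis[OF subfield_Z l] by blast
  have eM: "e \<in> {..<l} \<rightarrow> M" using lin_span_base[OF subring_Z _ e(1)] e(3) by auto
  then have eB: "e \<in> {..<l} \<rightarrow> B" using M_subset_B by auto
  have ZB: "Z \<subseteq> B" using Z_subset_M M_subset_B by blast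
  have xB: "x \<in> carrier G \<rightarrow> B" using x_in_B by blast
  have indep: "B.lin_indep (ring_center BR) {..<l} e"
    unfolding center_B using lin_indep_consistent[OF subring_B ZB eB] e(2) by blast
  have span: "M \<subseteq> B.lin_span (ring_center BR) {..<l} e"
    unfolding center_B using lin_span_consistent[OF subring_B ZB eB] e(3) by blast
  have spanB: "carrier BR \<subseteq> B.lin_span M (carrier G) x"
    using lin_span_consistent[OF subring_B M_subset_B xB] B_eq by simp
  have indepB: "B.lin_indep M (carrier G) x"
    using lin_indep_consistent[OF subring_B M_subset_B xB] lin_indep_x by blast
  have "subring M BR"
    using B.subring_iff[of M] M_subset_B subring_is_ring[OF subring_M] by simp
  moreover have "centralizer BR M \<subseteq> M"
    using centralizer_M subringE(1)[OF subring_B] unfolding centralizer_def by auto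
  ultimately have "card (carrier G) \<le> card {..<l}"
    using B.card_lin_indep_le[OF _ finite_G, of "{..<l}" M e x] span indepB eB xB by auto
  moreover have "card {..<l} \<le> card (carrier G)"
  \<comment> \<open>The coefficient set commuting with \<open>e\<close> is \<open>M\<close> itself,
    by commutativity.\<close>
  proof (rule B.card_le_of_left_spanning[OF _ finite_G _ _ indep _ _ spanB])
    show "c \<otimes>\<^bsub>BR\<^esub> e i = e i \<otimes>\<^bsub>BR\<^esub> c" if "i \<in> {..<l}" "c \<in> M" for i c
      using M_comm[of c "e i"] eM that by auto
  qed (use eB xB M_subset_B in auto)
  ultimately show ?thesis using l by simp
qed

lemma dimension_B_Z: "dimension ((card (carrier G))\<^sup>2) Z B"
  using telescopic_base[OF subfield_Z subfield_M M_over_Z dimension_B] by (simp add: power2_eq_square)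

lemma has_degree_B: "has_degree Z BR (card (carrier G))"
  unfolding has_degree_def
  using dimension_consistent[OF subring_B _ subfield_Z dimension_B_Z] Z_subset_M M_subset_B by simp

lemma central_division_algebra_B: "central_division_algebra Z BR"
proof (intro central_division_algebra.intro central_division_algebra_axioms.intro)
  show "ring BR" by (rule B.ring_axioms)
  show "subfield Z BR"
    using subfield_in_subring[OF subring_B B_inv subfield_Z] Z_subset_M M_subset_B by blast
  show "ring_center BR = Z" by (rule center_B)
  show "B.finite_dimension Z (carrier BR)"
    using has_degree_B B.finite_dimensionI unfolding has_degree_def by blast
  show "Units BR = carrier BR - {\<zero>\<^bsub>BR\<^esub>}" by (rule B.units)
qed

lemma crossed_product_iso_B: "crossed_product_iso Z M cocycle BR (left_comb A G x)"
proof -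
  \<comment> \<open>As \<open>aut_group Z L\<close> is \<open>G\<close>, the condition on the fixed
    field is the definition of \<open>Z\<close>; the finiteness comes from
    \<open>M_over_Z\<close>.\<close>
  have "galois_extension Z L"
    unfolding galois_extension_def aut_group_Z
  proof (intro conjI)
    show "field L" using subfield_iff(2)[OF subfield_M] .
    show "subfield Z L" using subfield_in_subring[OF subring_M M_inv subfield_Z Z_subset_M] .
    show "L.finite_dimension Z (carrier L)"
      using L.finite_dimensionI[OF dimension_consistent[OF subring_M Z_subset_M subfield_Z M_over_Z]] by simp
  qed (rule refl)
  moreover have "subfield M BR" using subfield_in_subring[OF subring_B B_inv subfield_M M_subset_B] .
  ultimately show ?thesis
    unfolding crossed_product_iso_def Let_def
    using factor_set_cocycle left_comb_iso left_comb_embed(2) by (simp add: aut_group_Z)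
qed

lemma cyclic_of_prime_degree:
  assumes p: "Factorial_Ring.prime p" "has_degree F A p" and nontriv: "\<not> trivial_group G"
  shows "cyclic_algebra F A p"
proof -
  obtain n where n: "has_degree F A n" "dimension n F M" "dimension n M (carrier A)"
    using obtain_bases by metis
  have "n\<^sup>2 = p\<^sup>2"
    using dimension_is_inj[OF base_subfield] n(1) p(2) unfolding has_degree_def by blast
  then have np: "n = p" by simp
  let ?g = "card (carrier G)"
  \<comment> \<open>This provides a finite dimension \<open>k\<close> of \<open>Z\<close> over
    \<open>F\<close>, so that the tower from \<open>F\<close> through \<open>Z\<close> to
    \<open>M\<close> reads \<open>k * ?g = p\<close>.\<close>
  have "subalgebra F Z A"
  proof (intro subalgebra.intro subalgebra_axioms.intro)
    show "subgroup Z (add_monoid A)" by (rule subring.axioms(1)[OF subring_Z])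
    show "z \<otimes> v \<in> Z" if "z \<in> F" "v \<in> Z" for z v
      by (rule subringE(6)[OF subring_Z subsetD[OF F_subset_Z that(1)] that(2)])
  qed
  then obtain k where k: "dimension k F Z"
    using subalbegra_incl_imp_finite_dimension[OF base_subfield finite_dim] subringE(1)[OF subring_Z]
    by blast
  have kg: "k * ?g = p"
    using dimension_is_inj[OF base_subfield telescopic_base[OF base_subfield subfield_Z k M_over_Z] n(2)] np
    by simp
  have "?g \<noteq> 1"
  proof
    assume "?g = 1"
    then obtain \<sigma> where "carrier G = {\<sigma>}" by (rule card_1_singletonE)
    then show False using nontriv G.trivial_group by blast
  qed
  moreover have "?g dvd p" using kg by (metis dvd_triv_right)
  ultimately have g: "?g = p" using p(1) prime_nat_iff by blast
  then have k1: "k = 1" using kg prime_gt_0_nat[OF p(1)] by simp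
  have "F = Z"
    using dimension_subset_eq[OF base_subfield k _ F_subset_Z] dimension_one[OF base_subfield] k1 by blast
  \<comment> \<open>Both spaces have dimension \<open>p\<close> over \<open>M\<close>. The record
    \<open>BR\<close> then coincides with \<open>A\<close>, and the isomorphism found for
    \<open>BR\<close> is one for \<open>A\<close>.\<close>
  moreover have "B = carrier A"
    using dimension_subset_eq[OF subfield_M n(3)] dimension_B subringE(1)[OF subring_B] g np by simp
  ultimately have "crossed_product_iso F M cocycle A (left_comb A G x)"
    using crossed_product_iso_B by simp
  moreover have "cyclic_group G" using G.cyclic_group_prime_card g p(1) by simp
  ultimately show ?thesis
    unfolding cyclic_algebra_def using n(2) np by blast
qed

end

section \<open>Both statements for an arbitrary central division algebra\<close>

theorem corollary6:
  fixes A :: "('a, 'b) ring_scheme" and F :: "'a set"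
  assumes "central_division_algebra F A"
  shows "(\<forall>p::nat. Factorial_Ring.prime p \<and> has_degree F A p \<longrightarrow>
            cyclic_algebra F A p \<or>
            (\<forall>M. maximal_subfield F A M \<longrightarrow> trivial_group (aut_group F (A\<lparr>carrier := M\<rparr>))))
       \<and> (\<forall>M G Z. maximal_subfield F A M \<and> G = aut_group F (A\<lparr>carrier := M\<rparr>) \<and>
            \<not> trivial_group G \<and> Z = fixed_field (A\<lparr>carrier := M\<rparr>) G \<longrightarrow>
            (\<exists>x. inducing_family A M G x) \<and>
            (\<forall>x. inducing_family A M G x \<longrightarrow>
               (let B = A\<lparr>carrier := M_of_G A M G x\<rparr> in
                  subring (carrier B) A \<and> F \<subseteq> carrier B \<and>
                  central_division_algebra Z B \<and> has_degree Z B (card (carrier G)) \<and>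
                  aut_group Z (A\<lparr>carrier := M\<rparr>) = G \<and>
                  (\<exists>a. (\<forall>\<sigma> \<in> carrier G. \<forall>\<tau> \<in> carrier G.
                          x \<sigma> \<otimes>\<^bsub>A\<^esub> x \<tau> = a \<sigma> \<tau> \<otimes>\<^bsub>A\<^esub> x (\<sigma> \<otimes>\<^bsub>G\<^esub> \<tau>)) \<and>
                       crossed_product_iso Z M a B (left_comb A G x)))))"
proof (intro conjI allI impI; (elim conjE)?)
  fix p :: nat assume p: "Factorial_Ring.prime p" "has_degree F A p"
  show "cyclic_algebra F A p \<or>
    (\<forall>M. maximal_subfield F A M \<longrightarrow> trivial_group (aut_group F (A\<lparr>carrier := M\<rparr>)))"
  proof (rule disjCI)
    assume "\<not> (\<forall>M. maximal_subfield F A M \<longrightarrow> trivial_group (aut_group F (A\<lparr>carrier := M\<rparr>)))"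
    then obtain M where M: "maximal_subfield F A M"
        "\<not> trivial_group (aut_group F (A\<lparr>carrier := M\<rparr>))" by blast
    interpret maximal_subfield_algebra F A M
      using assms M(1) by (simp add: maximal_subfield_algebra_def maximal_subfield_algebra_axioms_def)
    obtain x where "inducing_family A M G x" using ex_inducing by blast
    then interpret induced_crossed_product F A M x by unfold_locales
    show "cyclic_algebra F A p" by (rule cyclic_of_prime_degree[OF p M(2)])
  qed
next
  fix M G Z
  assume M: "maximal_subfield F A M" and G: "G = aut_group F (A\<lparr>carrier := M\<rparr>)"
    and Z: "Z = fixed_field (A\<lparr>carrier := M\<rparr>) G"
  interpret S: maximal_subfield_algebra F A M
    using assms M by (simp add: maximal_subfield_algebra_def maximal_subfield_algebra_axioms_def)
  show "\<exists>x. inducing_family A M G x" unfolding G by (rule S.ex_inducing)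
  fix x assume "inducing_family A M G x"
  then interpret I: induced_crossed_product F A M x unfolding G by unfold_locales
  show "let B = A\<lparr>carrier := M_of_G A M G x\<rparr> in
      subring (carrier B) A \<and> F \<subseteq> carrier B \<and>
      central_division_algebra Z B \<and> has_degree Z B (card (carrier G)) \<and>
      aut_group Z (A\<lparr>carrier := M\<rparr>) = G \<and>
      (\<exists>a. (\<forall>\<sigma> \<in> carrier G. \<forall>\<tau> \<in> carrier G.
              x \<sigma> \<otimes>\<^bsub>A\<^esub> x \<tau> = a \<sigma> \<tau> \<otimes>\<^bsub>A\<^esub> x (\<sigma> \<otimes>\<^bsub>G\<^esub> \<tau>)) \<and>
           crossed_product_iso Z M a B (left_comb A G x))"
    unfolding Let_def Z G
  proof (intro conjI exI[of _ I.cocycle] ballI)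
    show "subring (carrier I.BR) A" using I.subring_B by simp
    show "F \<subseteq> carrier I.BR" using S.F_subset_M I.M_subset_B by simp
  qed (use I.central_division_algebra_B I.has_degree_B I.aut_group_Z I.x_mult
      I.crossed_product_iso_B in simp_all)
qed

end
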